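(* Let $d\ge1$, let $A=a_dx^d+a_{d-1}x^{d-1}+\cdots+a_1x+a_0\in\mathbb{Z}[x]$, $a_0\ge2$, $a_d\ne0$, be an expanding polynomial, and let $\mathcal{N}=\{0,\ldots,a_0-1\}$. Then: (1) The collection $\{\mathcal{G}_A(P)\mid P\in\Lambda_A\}$ forms a weak $m$-tiling of $\mathbb{R}^d$ for some $m\ge1$. (2) If $(A,\mathcal{N})$ is a canonical number system (CNS), then $\{\mathcal{G}_A(P)\mid P\in\Lambda_A\}$ forms a weak tiling of $\mathbb{R}^d$.
   Context: A polynomial is expanding if all its complex roots have modulus strictly larger than $1$. Let $\mathcal{Q}=\mathbb{Z}[x]/A\mathbb{Z}[x]$ and let $X$ be the image of $x$ in $\mathcal{Q}$. CNS. An $(A,\mathcal{N})$-representation of $P\in\mathcal{Q}$ is a sequence $(b_n)_{n\ge0}$ with $b_n\in\mathcal{N}$ such that $P-\sum_{n=0}^{k-1}b_nX^n\in X^k\mathcal{Q}$ for all $k\in\mathbb{N}$; every $P\in\mathcal{Q}$ has exactly one. $(A,\mathcal{N})$ is a CNS if for every $P\in\mathcal{Q}$ this representation has only finitely many non-zero entries. Brunotte tiles. The backward division mapping $D_A:\mathcal{Q}\to\mathcal{Q}$ is the well-defined map sending $P=\sum_{i=0}^\ell p_iX^i$ ($p_i\in\mathbb{Z}$) to $D_A(P)=\sum_{i=0}^{\ell-1}p_{i+1}X^i-\sum_{i=0}^{d-1}q\,a_{i+1}X^i$, $q=\lfloor p_0/a_0\rfloor$; $D_A^{-n}(P)$ denotes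 the preimage of $P$ under $D_A^n$. Let $W_0=a_d$ and $W_k=XW_{k-1}+a_{d-k}$ for $1\le k\le d-1$ (elements of $\mathcal{Q}$). The Brunotte module $\Lambda_A$ is the $\mathbb{Z}$-submodule of $\mathcal{Q}$ generated by $W_0,\ldots,W_{d-1}$ (which are a basis of it), and $\Psi_A:\Lambda_A\to\mathbb{Z}^d$ is the bijection $\sum_{k=0}^{d-1}z_kW_k\mapsto(z_0,\ldots,z_{d-1})^t$. Let $\mathbf{r}=(r_0,\ldots,r_{d-1})=\big(\frac{a_d}{a_0},\frac{a_{d-1}}{a_0},\ldots,\frac{a_1}{a_0}\big)$ and let $M_\mathbf{r}\in\mathbb{R}^{d\times d}$ be the matrix with last row $(-r_0,\ldots,-r_{d-1})$, entries $1$ on the superdiagonal of the first $d-1$ rows, and $0$ elsewhere. Let $V\in\mathbb{R}^{d\times d}$ be upper triangular with $V_{ij}=a_{d-(j-i)}$ for $1\le i\le j\le d$ and $V_{ij}=0$ for $i>j$, and $B=VM_\mathbf{r}^{-1}V^{-1}$. For $P\in\Lambda_A$ the Brunotte tile is $\mathcal{G}_A(P)=\mathrm{Li}_{n\to\infty}B^{-n}V\Psi_A\big(D_A^{-n}(P)\cap\Lambda_A\big)$, where the lower Hausdorff limit $\mathrm{Li}_{n\to\infty}A_n$ is the set of all $\mathbf{t}\in\mathbb{R}^d$ such that each neighbourhood of $\mathbf{t}$ intersects $A_n$ for all sufficiently large $n$. Weak tilings. For a locally finite family $\mathcal{K}=(K_i)_{i\in I}$ of compact sets covering $\mathbb{R}^d$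 (locally finite: every open ball meets only finitely many members; here the index set is $\Lambda_A$) let $\deg(\mathcal{K},\mathbf{t})=\#\{i\in I\mid\mathbf{t}\in K_i\}$ and $\deg(\mathcal{K})=\min_{\mathbf{t}\in\mathbb{R}^d}\deg(\mathcal{K},\mathbf{t})$. $\mathcal{K}$ is a weak $m$-tiling if $\deg(\mathcal{K})=m$ and $\bigcap_{k=1}^{m+1}\mathrm{int}(K_{i_k})=\emptyset$ for all pairwise different $i_1,\ldots,i_{m+1}\in I$. A weak tiling is a weak $1$-tiling. *)

theory Defs
  imports
    "HOL-Analysis.Analysis"
    "HOL-Algebra.QuotRing"
    "HOL-Algebra.Algebraic_Closure_Type"
    "HOL-Computational_Algebra.Polynomial"
begin

hide_const (open) UnivPoly.coeff UnivPoly.monom Polynomials.degree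

definition expanding :: "int poly \<Rightarrow> bool" where
  "expanding A \<longleftrightarrow> (\<forall>z::complex. poly (map_poly of_int A) z = 0 \<longrightarrow> norm z > 1)"

section \<open>The quotient ring and canonical number systems\<close>

abbreviation int_poly_ring :: "int poly ring" where
  "int_poly_ring \<equiv> ring_of_type_algebra"

text \<open>Elements of \<^term>\<open>Q A\<close> are cosets, i.e. sets of integer polynomials; \<^term>\<open>qcls A p\<close> is the
  image of the polynomial \<^term>\<open>p\<close>.\<close>

definition Q :: "int poly \<Rightarrow> int poly set ring" where
  "Q A = int_poly_ring Quot (PIdl\<^bsub>int_poly_ring\<^esub> A)"

definition qcls :: "int poly \<Rightarrow> int poly \<Rightarrow> int poly set" where
  "qcls A p = (PIdl\<^bsub>int_poly_ring\<^esub> A) +>\<^bsub>int_poly_ring\<^esub> p"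

definition qX :: "int poly \<Rightarrow> int poly set" where
  "qX A = qcls A [:0, 1:]"

definition is_representation ::
    "int poly \<Rightarrow> int set \<Rightarrow> int poly set \<Rightarrow> (nat \<Rightarrow> int) \<Rightarrow> bool" where
  "is_representation A N P b \<longleftrightarrow>
     (\<forall>n. b n \<in> N) \<and>
     (\<forall>k. P \<ominus>\<^bsub>Q A\<^esub> (\<Oplus>\<^bsub>Q A\<^esub>n\<in>{..<k}. [b n] \<cdot>\<^bsub>Q A\<^esub> (qX A [^]\<^bsub>Q A\<^esub> n))
          \<in> {(qX A [^]\<^bsub>Q A\<^esub> k) \<otimes>\<^bsub>Q A\<^esub> R | R. R \<in> carrier (Q A)})"

text \<open>For \<open>N = {0, \<dots>, a\<^sub>0 - 1}\<close> every element has exactly one representation, so the existential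
  quantifier below speaks about that representation.\<close>

definition CNS :: "int poly \<Rightarrow> int set \<Rightarrow> bool" where
  "CNS A N \<longleftrightarrow>
     (\<forall>P\<in>carrier (Q A). \<exists>b. is_representation A N P b \<and> finite {n. b n \<noteq> 0})"

section \<open>The backward division mapping\<close>

text \<open>On representatives; \<open>div\<close> on \<^typ>\<open>int\<close> rounds towards minus infinity, so
  \<open>q = p\<^sub>0 div a\<^sub>0\<close> is the floor of the rational quotient.\<close>

definition backward_div_poly :: "int poly \<Rightarrow> int poly \<Rightarrow> int poly" where
  "backward_div_poly A p =
     (let q = coeff p 0 div coeff A 0
      in (\<Sum>i<degree p. monom (coeff p (Suc i)) i)
         - (\<Sum>i<degree A. monom (q * coeff A (Suc i)) i))"

definition backward_div :: "int poly \<Rightarrow> int poly set \<Rightarrow> int poly set" where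
  "backward_div A P = the_elem ((\<lambda>p. qcls A (backward_div_poly A p)) ` P)"

section \<open>The Brunotte module\<close>

primrec brunotte_W :: "int poly \<Rightarrow> nat \<Rightarrow> int poly set" where
  "brunotte_W A 0 = qcls A [:coeff A (degree A):]"
| "brunotte_W A (Suc k) =
     qX A \<otimes>\<^bsub>Q A\<^esub> brunotte_W A k \<oplus>\<^bsub>Q A\<^esub> qcls A [:coeff A (degree A - Suc k):]"

text \<open>A \<open>\<int>\<close>-submodule is the same thing as an additive subgroup.\<close>

definition brunotte_module :: "int poly \<Rightarrow> int poly set set" where
  "brunotte_module A = generate (add_monoid (Q A)) (brunotte_W A ` {..<degree A})"

text \<open>Coordinates of vectors and matrices are indexed by a finite well-ordered type; \<open>pos i\<close> is the
  position of \<open>i\<close>, counted from \<open>0\<close>. It maps the index type \<^typ>\<open>'n\<close> increasingly onto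
  \<open>{0, \<dots>, CARD('n) - 1}\<close>.\<close>

definition pos :: "'n::{finite,wellorder} \<Rightarrow> nat" where
  "pos i = card {..<i}"

definition brunotte_comb :: "int poly \<Rightarrow> int ^ 'n::{finite,wellorder} \<Rightarrow> int poly set" where
  "brunotte_comb A z = (\<Oplus>\<^bsub>Q A\<^esub>i\<in>UNIV. [z $ i] \<cdot>\<^bsub>Q A\<^esub> brunotte_W A (pos i))"

definition brunotte_Psi :: "int poly \<Rightarrow> int poly set \<Rightarrow> int ^ 'n::{finite,wellorder}" where
  "brunotte_Psi A P = (THE z. brunotte_comb A z = P)"

section \<open>Brunotte tiles\<close>

definition r_vec :: "int poly \<Rightarrow> nat \<Rightarrow> real" where
  "r_vec A j = real_of_int (coeff A (degree A - j)) / real_of_int (coeff A 0)"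

definition M_mat :: "(nat \<Rightarrow> real) \<Rightarrow> real ^ 'n::{finite,wellorder} ^ 'n::{finite,wellorder}" where
  "M_mat r = (\<chi> i j. if pos i = CARD('n) - 1 then - r (pos j)
                     else if pos j = pos i + 1 then 1 else 0)"

definition V_mat :: "int poly \<Rightarrow> real ^ 'n::{finite,wellorder} ^ 'n::{finite,wellorder}" where
  "V_mat A = (\<chi> i j. if i \<le> j then real_of_int (coeff A (degree A - (pos j - pos i))) else 0)"

definition B_mat :: "int poly \<Rightarrow> real ^ 'n::{finite,wellorder} ^ 'n::{finite,wellorder}" where
  "B_mat A = V_mat A ** matrix_inv (M_mat (r_vec A)) ** matrix_inv (V_mat A)"

text \<open>The library's \<open>^\<close> on \<open>real ^ 'n ^ 'n\<close> is the entrywise power, hence the following.\<close>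

primrec mat_power :: "real ^ 'n ^ 'n \<Rightarrow> nat \<Rightarrow> real ^ 'n ^ 'n" where
  "mat_power M 0 = mat 1"
| "mat_power M (Suc n) = M ** mat_power M n"

definition lower_limit :: "(nat \<Rightarrow> 'a::topological_space set) \<Rightarrow> 'a set" where
  "lower_limit S =
     {t. \<forall>U. open U \<and> t \<in> U \<longrightarrow> (\<forall>\<^sub>F n in sequentially. U \<inter> S n \<noteq> {})}"

definition brunotte_tile ::
    "int poly \<Rightarrow> int poly set \<Rightarrow> (real ^ 'n::{finite,wellorder}) set" where
  "brunotte_tile A P = lower_limit (\<lambda>n.
     (\<lambda>R. mat_power (matrix_inv (B_mat A)) n *v
            (V_mat A *v (\<chi> i. real_of_int (brunotte_Psi A R $ i)))) `
     ({R \<in> carrier (Q A). (backward_div A ^^ n) R = P} \<inter> brunotte_module A))"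

section \<open>Weak tilings\<close>

definition covering_degree_at :: "'i set \<Rightarrow> ('i \<Rightarrow> 'a set) \<Rightarrow> 'a \<Rightarrow> nat" where
  "covering_degree_at I K t = card {i \<in> I. t \<in> K i}"

text \<open>The infimum of a nonempty set of natural numbers is its minimum.\<close>

definition covering_degree :: "'i set \<Rightarrow> ('i \<Rightarrow> 'a set) \<Rightarrow> nat" where
  "covering_degree I K = (INF t. covering_degree_at I K t)"

definition locally_finite_family :: "'i set \<Rightarrow> ('i \<Rightarrow> 'a::metric_space set) \<Rightarrow> bool" where
  "locally_finite_family I K \<longleftrightarrow> (\<forall>x r. finite {i \<in> I. ball x r \<inter> K i \<noteq> {}})"

definition weak_m_tiling ::
    "nat \<Rightarrow> 'i set \<Rightarrow> ('i \<Rightarrow> 'a::euclidean_space set) \<Rightarrow> bool" where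
  "weak_m_tiling m I K \<longleftrightarrow>
     locally_finite_family I K \<and>
     (\<forall>i\<in>I. compact (K i)) \<and>
     (\<Union>i\<in>I. K i) = UNIV \<and>
     covering_degree I K = m \<and>
     (\<forall>J. J \<subseteq> I \<and> card J = m + 1 \<longrightarrow> (\<Inter>i\<in>J. interior (K i)) = {})"

abbreviation weak_tiling :: "'i set \<Rightarrow> ('i \<Rightarrow> 'a::euclidean_space set) \<Rightarrow> bool" where
  "weak_tiling \<equiv> weak_m_tiling 1"

section \<open>Well-definedness\<close>

text \<open>The choices hidden in \<^const>\<open>backward_div\<close> and \<^const>\<open>brunotte_Psi\<close> are legitimate: the
  former does not depend on representatives (\<open>backward_div_qcls\<close>), and \<^const>\<open>brunotte_comb\<close> is a
  bijection onto the Brunotte module (\<open>brunotte_comb_inj\<close>, \<open>range_brunotte_comb\<close>).\<close>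

lemma qcls_altdef: "qcls A p = {p'. A dvd p' - p}"
proof -
  have "qcls A p = {f * A + p | f. True}"
    by (auto simp: qcls_def cgenideal_def a_r_coset_def r_coset_def ring_of_type_algebra_def)
  also have "\<dots> = {p'. A dvd p' - p}"
    unfolding dvd_def diff_eq_eq by (auto simp: mult.commute)
  finally show ?thesis .
qed

lemma qcls_eq_iff: "qcls A p = qcls A p' \<longleftrightarrow> A dvd p - p'"
proof
  assume "qcls A p = qcls A p'"
  moreover have "p \<in> qcls A p" by (simp add: qcls_altdef)
  ultimately show "A dvd p - p'" by (simp add: qcls_altdef)
next
  assume *: "A dvd p - p'"
  have "A dvd r - p \<longleftrightarrow> A dvd r - p'" for r
    using dvd_add[OF _ *, of "r - p"] dvd_diff[OF _ *, of "r - p'"] by auto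
  thus "qcls A p = qcls A p'" by (simp add: qcls_altdef)
qed

lemma ideal_cgenideal_int_poly: "ideal (PIdl\<^bsub>int_poly_ring\<^esub> A) int_poly_ring"
  by (intro cring.cgenideal_ideal cring_from_type_algebra) (simp add: ring_of_type_algebra_def)

lemma cring_Q: "cring (Q A)"
  unfolding Q_def by (intro ideal.quotient_is_cring ideal_cgenideal_int_poly cring_from_type_algebra)

lemma carrier_Q: "carrier (Q A) = range (qcls A)"
  by (auto simp: Q_def FactRing_def A_RCOSETS_def RCOSETS_def qcls_def a_r_coset_def 
      ring_of_type_algebra_def)

lemma qcls_hom: "qcls A \<in> ring_hom int_poly_ring (Q A)"
  using ideal.rcos_ring_hom[OF ideal_cgenideal_int_poly[of A]]
  unfolding qcls_def[abs_def] Q_def .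

lemma qcls_add: "qcls A p \<oplus>\<^bsub>Q A\<^esub> qcls A p' = qcls A (p + p')"
  and qcls_mult: "qcls A p \<otimes>\<^bsub>Q A\<^esub> qcls A p' = qcls A (p * p')"
  and qcls_one: "\<one>\<^bsub>Q A\<^esub> = qcls A 1"
  and qcls_zero: "\<zero>\<^bsub>Q A\<^esub> = qcls A 0"
proof -
  show "qcls A p \<oplus>\<^bsub>Q A\<^esub> qcls A p' = qcls A (p + p')"
    using ring_hom_add[OF qcls_hom, of p p' A] by (simp add: ring_of_type_algebra_def)
  show "qcls A p \<otimes>\<^bsub>Q A\<^esub> qcls A p' = qcls A (p * p')"
    using ring_hom_mult[OF qcls_hom, of p p' A] by (simp add: ring_of_type_algebra_def)
  show "\<one>\<^bsub>Q A\<^esub> = qcls A 1"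
    using ring_hom_one[OF qcls_hom, of A] by (simp add: ring_of_type_algebra_def)
  show "\<zero>\<^bsub>Q A\<^esub> = qcls A 0"
    using ring_hom_zero[OF qcls_hom ring_from_type_algebra, of A] cring.axioms(1)[OF cring_Q[of A]]
    by (simp add: ring_of_type_algebra_def)
qed

lemma backward_div_poly_eq:
  assumes "coeff A 0 > 0"
  shows "pCons 0 (backward_div_poly A p) =
    p - [: coeff p 0 :] - Polynomial.smult (coeff p 0 div coeff A 0) (A - [: coeff A 0 :])"
proof (rule poly_eqI)
  have sh: "coeff (\<Sum>i<degree r. monom (c * coeff r (Suc i)) i) n = c * coeff r (Suc n)" for r :: "int poly" and c n
    by (auto simp: coeff_sum coeff_monom not_less intro!: coeff_eq_0)
  show "coeff (pCons 0 (backward_div_poly A p)) n =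
    coeff (p - [: coeff p 0 :] - Polynomial.smult (coeff p 0 div coeff A 0) (A - [: coeff A 0 :])) n" for n
    using sh[of 1 p] by (cases n) (simp_all add: backward_div_poly_def sh Let_def)
qed

lemma backward_div_poly_cong:
  assumes "coeff A 0 > 0" "A dvd p - p'"
  shows "A dvd backward_div_poly A p - backward_div_poly A p'"
proof -
  obtain g where g: "p = p' + A * g" using assms(2) by (metis add_diff_cancel_left' diff_add_cancel add.commute dvdE)
  have "coeff p 0 = coeff p' 0 + coeff A 0 * coeff g 0" by (simp add: g coeff_mult_0)
  hence q: "coeff p 0 div coeff A 0 = coeff p' 0 div coeff A 0 + coeff g 0" using assms(1) by simp
  obtain h where h: "g = pCons (coeff g 0) h" by (metis coeff_pCons_0 pCons_cases)
  have "pCons 0 (backward_div_poly A p) - pCons 0 (backward_div_poly A p') = 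
      A * g - Polynomial.smult (coeff g 0) A"
    unfolding backward_div_poly_eq[OF assms(1)] q
    by (simp add: g coeff_mult_0 algebra_simps smult_add_left smult_diff_right)
  also have "\<dots> = pCons 0 (A * h)"
    by (subst h, subst mult_pCons_right) simp
  finally show ?thesis by simp
qed

lemma backward_div_qcls:
  assumes "coeff A 0 > 0"
  shows "backward_div A (qcls A p) = qcls A (backward_div_poly A p)"
proof -
  have "p \<in> qcls A p" by (simp add: qcls_altdef)
  moreover have "qcls A (backward_div_poly A r) = qcls A (backward_div_poly A p)" if "r \<in> qcls A p" for r
    using that backward_div_poly_cong[OF assms] by (simp add: qcls_eq_iff) (simp add: qcls_altdef)
  ultimately have "(\<lambda>r. qcls A (backward_div_poly A r)) ` qcls A p = {qcls A (backward_div_poly A p)}"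
    by blast
  thus ?thesis by (simp add: backward_div_def)
qed


lemma qcls_add_pow: "[(z::int)] \<cdot>\<^bsub>Q A\<^esub> qcls A p = qcls A (of_int z * p)"
proof -
  interpret cring "Q A" by (rule cring_Q)
  have c: "qcls A r \<in> carrier (Q A)" for r by (simp add: carrier_Q)
  have n: "[(n::nat)] \<cdot>\<^bsub>Q A\<^esub> qcls A p = qcls A (of_nat n * p)" for n
    by (induction n) (simp_all add: qcls_zero qcls_add algebra_simps)
  have neg: "\<ominus>\<^bsub>Q A\<^esub> qcls A r = qcls A (- r)" for r
    by (rule minus_equality) (simp_all add: c qcls_add qcls_zero)
  show ?thesis
  proof (cases z rule: int_cases2)
    case (nonneg m)
    thus ?thesis using n[of m] by (simp add: add_pow_def int_pow_int)
  next
    case (nonpos m)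
    have "[(- int m)] \<cdot>\<^bsub>Q A\<^esub> qcls A p = \<ominus>\<^bsub>Q A\<^esub> ([m] \<cdot>\<^bsub>Q A\<^esub> qcls A p)"
      using add.int_pow_neg_int[OF c] by (simp add: a_inv_def add_pow_def)
    thus ?thesis using nonpos by (simp add: n neg)
  qed
qed

lemma qcls_finsum:
  assumes "finite I"
  shows "(\<Oplus>\<^bsub>Q A\<^esub>i\<in>I. qcls A (f i)) = qcls A (\<Sum>i\<in>I. f i)"
proof -
  interpret cring "Q A" by (rule cring_Q)
  show ?thesis using assms
    by (induction I) (simp_all add: qcls_zero qcls_add carrier_Q)
qed

primrec W_poly :: "int poly \<Rightarrow> nat \<Rightarrow> int poly" where
  "W_poly A 0 = [:coeff A (degree A):]"
| "W_poly A (Suc k) = pCons (coeff A (degree A - Suc k)) (W_poly A k)"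

lemma brunotte_W_eq: "brunotte_W A k = qcls A (W_poly A k)"
  by (induction k) (simp_all add: qX_def qcls_add qcls_mult)

lemma coeff_W_poly: "coeff (W_poly A k) n = (if n \<le> k then coeff A (degree A - k + n) else 0)" if "k \<le> degree A"
  using that
proof (induction k arbitrary: n)
  case 0 thus ?case by (auto simp: coeff_pCons split: nat.splits)
next
  case (Suc k)
  thus ?case by (cases n) (auto simp: Suc_diff_le Suc_diff_Suc)
qed

lemma brunotte_comb_eq:
  "brunotte_comb A z = qcls A (\<Sum>i\<in>UNIV. of_int (z $ i) * W_poly A (pos i))"
  unfolding brunotte_comb_def brunotte_W_eq qcls_add_pow by (rule qcls_finsum) simp

lemma pos_strict_mono: "i < j \<Longrightarrow> pos i < pos j"
  unfolding pos_def by (intro psubset_card_mono) auto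

lemma inj_pos: "inj pos"
  by (metis injI linorder_neqE less_irrefl pos_strict_mono)

lemma pos_less: "pos (i::'n::{finite,wellorder}) < CARD('n)"
  unfolding pos_def by (intro psubset_card_mono) auto

lemma range_pos: "range (pos :: 'n::{finite,wellorder} \<Rightarrow> nat) = {..<CARD('n::{finite,wellorder})}"
  using pos_less by (intro card_subset_eq) (auto simp: card_image inj_pos)

lemma brunotte_comb_inj:
  assumes "degree A = CARD('n::{finite,wellorder})"
  shows "inj (brunotte_comb A :: int ^ 'n::{finite,wellorder} \<Rightarrow> _)"
proof (rule injI)
  fix y z :: "int ^ 'n::{finite,wellorder}"
  assume eq: "brunotte_comb A y = brunotte_comb A z"
  define S where "S = (\<Sum>i\<in>UNIV. of_int ((y - z) $ i) * W_poly A (pos i))"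
  have cS: "coeff S n = (\<Sum>i\<in>UNIV. (y - z) $ i * coeff (W_poly A (pos i)) n)" for n
    by (simp add: S_def coeff_sum of_int_poly)
  have le: "pos i \<le> degree A" for i :: 'n using pos_less[of i] assms by simp
  have "A dvd S"
    using eq unfolding brunotte_comb_eq qcls_eq_iff
    by (simp add: S_def sum_subtractf algebra_simps)
  have "degree S < degree A"
  proof (rule degree_lessI)
    show "S \<noteq> 0 \<or> 0 < degree A" using assms by simp
    show "\<forall>k\<ge>degree A. coeff S k = 0"
    proof (intro allI impI)
      fix k assume "k \<ge> degree A"
      hence "\<not> k \<le> pos i" for i :: "'n::{finite,wellorder}" using pos_less[of i] assms by simp
      thus "coeff S k = 0" unfolding cS using le by (simp add: coeff_W_poly)
    qed
  qed
  with \<open>A dvd S\<close> have S0: "S = 0" by (meson dvd_imp_degree_le not_le)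
  show "y = z"
  proof (rule ccontr)
    assume "y \<noteq> z"
    then obtain i0 where "(y - z) $ i0 \<noteq> 0" by (auto simp: vec_eq_iff)
    define i where "i = Max {i. (y - z) $ i \<noteq> 0}"
    have max: "(y - z) $ j = 0" if "j > i" for j
      using that Max_ge[of "{i. (y - z) $ i \<noteq> 0}" j] unfolding i_def by fastforce
    have i: "(y - z) $ i \<noteq> 0"
      using Max_in[of "{i. (y - z) $ i \<noteq> 0}"] \<open>(y - z) $ i0 \<noteq> 0\<close> unfolding i_def by auto
    have "coeff S (pos i) = (\<Sum>j\<in>{i}. (y - z) $ j * coeff (W_poly A (pos j)) (pos i))"
      unfolding cS
    proof (rule sum.mono_neutral_right)
      show "\<forall>j\<in>UNIV - {i}. (y - z) $ j * coeff (W_poly A (pos j)) (pos i) = 0"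
      proof
        fix j assume "j \<in> UNIV - {i}"
        hence "j < i \<or> i < j" by auto
        thus "(y - z) $ j * coeff (W_poly A (pos j)) (pos i) = 0"
          using max[of j] pos_strict_mono[of j i] le[of j] by (auto simp: coeff_W_poly)
      qed
    qed auto
    also have "\<dots> = (y - z) $ i * coeff A (degree A)"
      using le[of i] by (simp add: coeff_W_poly)
    also have "\<dots> \<noteq> 0"
    proof -
      have "A \<noteq> 0" using assms by auto
      thus ?thesis using i by simp
    qed
    finally show False using S0 by simp
  qed
qed

lemma range_brunotte_comb:
  assumes "degree A = CARD('n::{finite,wellorder})"
  shows "range (brunotte_comb A :: int ^ 'n::{finite,wellorder} \<Rightarrow> _) = brunotte_module A"
proof
  interpret cring "Q A" by (rule cring_Q)
  have gen: "brunotte_W A ` {..<degree A} = range (\<lambda>i::'n. brunotte_W A (pos i))"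
    using range_pos[where 'n='n] assms by (metis image_image)
  have sub: "brunotte_W A ` {..<degree A} \<subseteq> carrier (Q A)"
    by (auto simp: brunotte_W_eq carrier_Q)
  have sg: "subgroup (brunotte_module A) (add_monoid (Q A))"
    unfolding brunotte_module_def by (rule add.generate_is_subgroup[OF sub])
  show "range (brunotte_comb A :: int ^ 'n::{finite,wellorder} \<Rightarrow> _) \<subseteq> brunotte_module A"
  proof clarify
    fix z :: "int ^ 'n::{finite,wellorder}"
    have W: "brunotte_W A (pos i) \<in> brunotte_module A" for i :: 'n
      unfolding brunotte_module_def gen by (intro generate.incl) auto
    have cW: "brunotte_W A (pos i) \<in> carrier (Q A)" for i :: 'n
      by (simp add: brunotte_W_eq carrier_Q)
    have WW: "[z $ i] \<cdot>\<^bsub>Q A\<^esub> brunotte_W A (pos i) \<in> brunotte_module A" for i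
      using add.subgroup_int_pow_closed[OF sg W] by (simp add: add_pow_def)
    have "(\<Oplus>\<^bsub>Q A\<^esub>i\<in>I. [z $ i] \<cdot>\<^bsub>Q A\<^esub> brunotte_W A (pos i)) \<in> brunotte_module A" if "finite I" for I
      using that
    proof induction
      case empty
      show ?case using subgroup.one_closed[OF sg] by simp
    next
      case (insert i I)
      show ?case using insert subgroup.m_closed[OF sg WW insert.IH]
        by (subst finsum_insert) (auto simp: cW)
    qed
    thus "brunotte_comb A z \<in> brunotte_module A" unfolding brunotte_comb_def by simp
  qed
  show "brunotte_module A \<subseteq> range (brunotte_comb A :: int ^ 'n::{finite,wellorder} \<Rightarrow> _)"
    unfolding brunotte_module_def
  proof (rule add.generate_subgroup_incl)
    show "brunotte_W A ` {..<degree A} \<subseteq> range (brunotte_comb A :: int ^ 'n::{finite,wellorder} \<Rightarrow> _)"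
    proof -
      have "brunotte_W A (pos i) = brunotte_comb A (axis i 1)" for i :: 'n
        unfolding brunotte_comb_eq brunotte_W_eq axis_def
        by (simp add: if_distrib[of "\<lambda>x. x * _"] if_distrib[of of_int] cong: if_cong)
      thus ?thesis unfolding gen by auto
    qed
    have add: "brunotte_comb A y \<oplus>\<^bsub>Q A\<^esub> brunotte_comb A z = brunotte_comb A (y + z)" for y z :: "int ^ 'n::{finite,wellorder}"
      by (simp add: brunotte_comb_eq qcls_add sum.distrib algebra_simps)
    have zero: "\<zero>\<^bsub>Q A\<^esub> = brunotte_comb A (0 :: int ^ 'n::{finite,wellorder})"
      by (simp add: brunotte_comb_eq qcls_zero)
    have carr: "brunotte_comb A z \<in> carrier (Q A)" for z :: "int ^ 'n::{finite,wellorder}"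
      by (simp add: brunotte_comb_eq carrier_Q)
    have neg: "\<ominus>\<^bsub>Q A\<^esub> brunotte_comb A z = brunotte_comb A (- z)" for z :: "int ^ 'n::{finite,wellorder}"
      by (rule minus_equality) (simp_all add: carr add zero)
    show "subgroup (range (brunotte_comb A :: int ^ 'n::{finite,wellorder} \<Rightarrow> _)) (add_monoid (Q A))"
    proof
      show "\<one>\<^bsub>add_monoid (Q A)\<^esub> \<in> range (brunotte_comb A :: int ^ 'n::{finite,wellorder} \<Rightarrow> _)" using zero by auto
    next
      fix P assume "P \<in> range (brunotte_comb A :: int ^ 'n::{finite,wellorder} \<Rightarrow> _)"
      then obtain z :: "int ^ 'n::{finite,wellorder}" where "P = brunotte_comb A z" by auto
      thus "inv\<^bsub>add_monoid (Q A)\<^esub> P \<in> range (brunotte_comb A :: int ^ 'n::{finite,wellorder} \<Rightarrow> _)"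
        using neg[of z] unfolding a_inv_def by simp
    qed (use carr add in auto)
  qed
qed

lemma brunotte_Psi_comb:
  assumes "degree A = CARD('n::{finite,wellorder})"
  shows "brunotte_Psi A (brunotte_comb A z) = (z :: int ^ 'n::{finite,wellorder})"
  unfolding brunotte_Psi_def using brunotte_comb_inj[OF assms] by (auto simp: inj_eq)

end

theory Submission
  imports Defs "HOL-Computational_Algebra.Fundamental_Theorem_Algebra"
begin

text \<open>In the basis \<open>W\<^sub>0, \<dots>, W\<^bsub>d-1\<^esub>\<close> backward division on the Brunotte module is the shift radix map
  \<open>\<tau> z = (z\<^sub>1, \<dots>, z\<^bsub>d-1\<^esub>, -\<lfloor>r z\<rfloor>)\<close>, which stays within bounded distance of the contraction \<open>M\<^sub>r\<close>; so the
  points \<open>M\<^sub>r\<^sup>n y\<close> along a backward orbit converge geometrically, and the tiles are compact, locally finite,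
  cover the space and satisfy the subdivision equation. Since \<open>r\<close> has denominator \<open>a\<^sub>0\<close>, \<open>\<tau>\<^sup>n\<close> commutes
  with translations by \<open>a\<^sub>0\<^sup>n \<int>\<^sup>d\<close>, which makes the family of tiles quasi-periodic: the minimal degree
  recurs with bounded gaps. A common interior point of too many tiles would, after subdivision, give
  arbitrarily large balls avoiding the minimal degree. Finally, \<open>0\<close> lies only in tiles of purely
  periodic points of \<open>\<tau>\<close>, and for a CNS the only such point is \<open>0\<close>.\<close>

unbundle no fps_syntax

section \<open>Tiles of contracting radix systems\<close>

lemma closed_lower_limit: "closed (lower_limit S)"
proof -
  have "open (- lower_limit S)"
  proof (subst open_subopen, rule ballI)
    fix x assume "x \<in> - lower_limit S"
    then obtain U where U: "open U" "x \<in> U" "\<not> (\<forall>\<^sub>F n in sequentially. U \<inter> S n \<noteq> {})"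
      unfolding lower_limit_def by blast
    from U(1,3) have "U \<subseteq> - lower_limit S" unfolding lower_limit_def by blast
    with U(1,2) show "\<exists>T. open T \<and> x \<in> T \<and> T \<subseteq> - lower_limit S" by blast
  qed
  thus ?thesis by (simp add: closed_def)
qed

text \<open>Pigeonhole for a sequence in a finite set. It later singles out one lattice point that
  occurs at infinitely many levels.\<close>

lemma frequently_constant:
  assumes "finite F" "\<And>n. g n \<in> F"
  shows "\<exists>x\<in>F. \<exists>\<^sub>F n in sequentially. g n = x"
proof (rule ccontr)
  assume "\<not> ?thesis"
  hence "\<forall>x\<in>F. \<forall>\<^sub>F n in sequentially. g n \<noteq> x" by (auto simp: frequently_def)
  with assms(1) have "\<forall>\<^sub>F n in sequentially. \<forall>x\<in>F. g n \<noteq> x" by (simp add: eventually_ball_finite)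
  thus False using assms(2) by (metis (mono_tags, lifting) eventually_happens trivial_limit_sequentially)
qed

text \<open>Isolates what the tiling argument needs: on the points \<open>\<iota> z\<close> the map
  \<open>\<tau>\<close> is the contraction \<open>C\<close> up to a bounded rounding error. In
  \<open>quasi_periodic\<close> the radius \<open>R\<close> may depend on \<open>n\<close> but not
  on \<open>t\<close>; the assumption says that \<open>\<tau> ^^ n\<close> is compatible with a
  relatively dense set of translations.\<close>

locale contracting_radix_system =
  fixes \<iota> :: "'z::ab_group_add \<Rightarrow> 'a::euclidean_space"
    and C :: "'a \<Rightarrow> 'a" and \<tau> :: "'z \<Rightarrow> 'z" and c :: real
  assumes linear_C: "linear C"
    and inj_C: "inj C"
    and summable_C: "summable (\<lambda>n. onorm (C ^^ n))"
    and iota_add: "\<iota> (x + y) = \<iota> x + \<iota> y"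
    and surj_tau: "surj \<tau>"
    and tau_near: "norm (\<iota> (\<tau> z) - C (\<iota> z)) \<le> c"
    and discrete: "finite {z. norm (\<iota> z) \<le> R}"
    and quasi_periodic: "\<exists>R. \<forall>t. \<exists>w w'. norm (\<iota> w' - t) \<le> R \<and> \<iota> w' = (C ^^ n) (\<iota> w) \<and>
          (\<forall>z. (\<tau> ^^ n) (z + w) = (\<tau> ^^ n) z + w')"
begin

definition tile :: "'z \<Rightarrow> 'a set" where
  "tile x = lower_limit (\<lambda>n. (\<lambda>y. (C ^^ n) (\<iota> y)) ` {y. (\<tau> ^^ n) y = x})"

text \<open>Tail of the summable series of rounding errors: it bounds the total displacement caused
  by all refinements beyond level \<open>n\<close>.\<close>

definition err :: "nat \<Rightarrow> real" where
  "err n = c * (\<Sum>k. onorm (C ^^ (k + n)))"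

section \<open>Norm estimates and approximation of tiles by finite levels\<close>

lemma linear_pow: "linear (C ^^ n)"
proof (induction n)
  case 0
  show ?case by (simp add: linear_id[unfolded id_def] id_def)
next
  case (Suc n)
  show ?case unfolding funpow.simps by (rule linear_compose[OF Suc linear_C])
qed

lemma norm_pow_le: "norm ((C ^^ n) v) \<le> onorm (C ^^ n) * norm v"
  using linear_pow[of n] by (simp add: linear_conv_bounded_linear onorm)

lemma onorm_pow_nonneg: "0 \<le> onorm (C ^^ n)"
  using linear_pow[of n] by (simp add: linear_conv_bounded_linear onorm_pos_le)

lemma c_nonneg: "0 \<le> c"
  using tau_near norm_ge_zero order_trans by blast

lemma pow_diff: "(C ^^ n) (u - v) = (C ^^ n) u - (C ^^ n) v"
  by (rule linear_diff[OF linear_pow])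

lemma inj_pow: "inj (C ^^ n)"
  by (rule inj_fn[OF inj_C])

lemma surj_pow: "surj (C ^^ n)"
  using linear_injective_imp_surjective[OF linear_pow inj_pow] by simp

lemma onorm_pow_tendsto: "(\<lambda>n. onorm (C ^^ n)) \<longlonglongrightarrow> 0"
  by (rule summable_LIMSEQ_zero[OF summable_C])

lemma err_tendsto: "err \<longlonglongrightarrow> 0"
proof -
  have "(\<lambda>n. c * (\<Sum>k. onorm (C ^^ (k + n)))) \<longlonglongrightarrow> c * 0"
    by (intro tendsto_mult_left suminf_exist_split2 summable_C)
  thus ?thesis by (simp add: err_def[abs_def])
qed

lemma sum_le_err: "c * (\<Sum>j<k. onorm (C ^^ (j + n))) \<le> err n"
  unfolding err_def
  using summable_ignore_initial_segment[OF summable_C, of n] onorm_pow_nonneg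
  by (intro mult_left_mono sum_le_suminf c_nonneg) auto

text \<open>Telescoping: the step from level \<open>m\<close> to level \<open>m + 1\<close> moves a
  point by \<open>C ^^ m\<close> applied to a vector of norm at most \<open>c\<close>. The induction
  peels off the step of highest level, so its hypothesis is used at \<open>\<tau> y\<close>.\<close>

lemma dist_backward_le:
  "norm ((C ^^ n) (\<iota> ((\<tau> ^^ k) y)) - (C ^^ (n + k)) (\<iota> y)) \<le> err n"
proof -
  have "norm ((C ^^ n) (\<iota> ((\<tau> ^^ k) y)) - (C ^^ (n + k)) (\<iota> y))
     \<le> c * (\<Sum>j<k. onorm (C ^^ (j + n)))"
  proof (induction k arbitrary: y)
    case 0
    show ?case by simp
  next
    case (Suc k)
    have "norm ((C ^^ (n + k)) (\<iota> (\<tau> y)) - (C ^^ (n + Suc k)) (\<iota> y))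
        = norm ((C ^^ (n + k)) (\<iota> (\<tau> y) - C (\<iota> y)))"
      by (simp add: pow_diff funpow_swap1)
    also have "\<dots> \<le> onorm (C ^^ (n + k)) * norm (\<iota> (\<tau> y) - C (\<iota> y))"
      by (rule norm_pow_le)
    also have "\<dots> \<le> onorm (C ^^ (n + k)) * c"
      by (intro mult_left_mono tau_near onorm_pow_nonneg)
    finally have "norm ((C ^^ (n + k)) (\<iota> (\<tau> y)) - (C ^^ (n + Suc k)) (\<iota> y))
        \<le> c * onorm (C ^^ (k + n))" by (simp add: ac_simps)
    with norm_triangle_mono[OF Suc.IH[of "\<tau> y"] this]
    show ?case by (simp add: funpow_swap1 algebra_simps)
  qed
  thus ?thesis using sum_le_err by (rule order_trans)
qed

text \<open>A point of the tile is close to points of some later level; applying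
  \<open>\<tau>\<close> to return from there to level \<open>n\<close> costs at most
  \<open>err n\<close>.\<close>

lemma tile_approx:
  assumes "t \<in> tile x" "\<delta> > 0"
  shows "\<exists>y. (\<tau> ^^ n) y = x \<and> norm ((C ^^ n) (\<iota> y) - t) < err n + \<delta>"
proof -
  have "\<forall>\<^sub>F N in sequentially. ball t \<delta> \<inter> (\<lambda>y. (C ^^ N) (\<iota> y)) ` {y. (\<tau> ^^ N) y = x} \<noteq> {}"
    using assms unfolding tile_def lower_limit_def by auto
  moreover have "\<forall>\<^sub>F N in sequentially. N \<ge> n" by (rule eventually_ge_at_top)
  ultimately have "\<forall>\<^sub>F N in sequentially. ball t \<delta> \<inter> (\<lambda>y. (C ^^ N) (\<iota> y)) ` {y. (\<tau> ^^ N) y = x} \<noteq> {} \<and> N \<ge> n"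
    by (rule eventually_conj)
  from eventually_happens'[OF sequentially_bot this] obtain N y where N: "N \<ge> n"
    and y': "(\<tau> ^^ N) y = x" "(C ^^ N) (\<iota> y) \<in> ball t \<delta>"
    by blast
  from le_Suc_ex[OF N] obtain k where "N = n + k" by blast
  with y' have y: "(\<tau> ^^ (n + k)) y = x" "norm ((C ^^ (n + k)) (\<iota> y) - t) < \<delta>"
    by (simp_all add: dist_norm norm_minus_commute)
  have "norm ((C ^^ n) (\<iota> ((\<tau> ^^ k) y)) - t) < err n + \<delta>"
    using norm_triangle_lt[of _ _ "err n + \<delta>", OF add_le_less_mono[OF dist_backward_le[of n k y] y(2)]] by simp
  moreover have "(\<tau> ^^ n) ((\<tau> ^^ k) y) = x" using y(1) by (simp add: funpow_add)
  ultimately show ?thesis by blast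
qed

lemma surj_tau_pow: "surj (\<tau> ^^ n)"
  by (rule surj_fn[OF surj_tau])

text \<open>Surjectivity of \<open>\<tau>\<close> carries an approximation at level \<open>n\<close>
  to all higher levels at cost \<open>err n\<close>. Hence infinitely many good levels suffice where
  the lower limit asks for almost all.\<close>

lemma tileI:
  assumes fr: "\<And>\<delta>. \<delta> > 0 \<Longrightarrow> \<exists>\<^sub>F n in sequentially. \<exists>y. (\<tau> ^^ n) y = x \<and> norm ((C ^^ n) (\<iota> y) - t) < \<delta>"
  shows "t \<in> tile x"
proof -
  have "\<forall>\<^sub>F N in sequentially. U \<inter> (\<lambda>y. (C ^^ N) (\<iota> y)) ` {y. (\<tau> ^^ N) y = x} \<noteq> {}"
    if "open U" "t \<in> U" for U
  proof -
    obtain \<delta> where \<delta>: "\<delta> > 0" "ball t \<delta> \<subseteq> U" using \<open>open U\<close> \<open>t \<in> U\<close> openE by blast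
    have "\<forall>\<^sub>F n in sequentially. err n < \<delta> / 2" using err_tendsto \<delta>(1) by (intro order_tendstoD) auto
    moreover have "\<exists>\<^sub>F n in sequentially. \<exists>y. (\<tau> ^^ n) y = x \<and> norm ((C ^^ n) (\<iota> y) - t) < \<delta> / 2"
      using \<delta>(1) by (intro fr) simp
    ultimately have "\<exists>\<^sub>F n in sequentially. (\<exists>y. (\<tau> ^^ n) y = x \<and> norm ((C ^^ n) (\<iota> y) - t) < \<delta> / 2) \<and> err n < \<delta> / 2"
      by (rule frequently_eventually_frequently[rotated])
    then obtain n y where n: "err n < \<delta> / 2" "(\<tau> ^^ n) y = x" "norm ((C ^^ n) (\<iota> y) - t) < \<delta> / 2"
      using frequently_ex by blast
    have "U \<inter> (\<lambda>y. (C ^^ N) (\<iota> y)) ` {y. (\<tau> ^^ N) y = x} \<noteq> {}" if "N \<ge> n" for N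
    proof -
      obtain k where N: "N = n + k" using le_Suc_ex[OF \<open>N \<ge> n\<close>] by blast
      obtain z where z: "y = (\<tau> ^^ k) z" using surj_tau_pow by (metis surjD)
      have "dist t ((C ^^ N) (\<iota> z)) < \<delta>"
        using n(1,3) dist_backward_le[of n k z] dist_triangle2[of t "(C ^^ N) (\<iota> z)" "(C ^^ n) (\<iota> y)"]
        unfolding N z dist_norm by (simp add: norm_minus_commute)
      hence "(C ^^ N) (\<iota> z) \<in> U" using \<delta>(2) by auto
      moreover have "(\<tau> ^^ N) z = x" unfolding N using n(2) z by (simp add: funpow_add)
      ultimately show ?thesis by blast
    qed
    thus ?thesis by (auto simp: eventually_sequentially)
  qed
  thus ?thesis unfolding tile_def lower_limit_def by blast
qed

lemma tileI_tendsto: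
  assumes f: "f \<longlonglongrightarrow> 0"
    and fr: "\<exists>\<^sub>F n in sequentially. \<exists>y. (\<tau> ^^ n) y = x \<and> norm ((C ^^ n) (\<iota> y) - t) \<le> f n"
  shows "t \<in> tile x"
proof (rule tileI)
  fix \<delta> :: real assume "\<delta> > 0"
  with f have "\<forall>\<^sub>F n in sequentially. f n < \<delta>" by (intro order_tendstoD)
  hence "\<forall>\<^sub>F n in sequentially. (\<exists>y. (\<tau> ^^ n) y = x \<and> norm ((C ^^ n) (\<iota> y) - t) \<le> f n) \<longrightarrow>
      (\<exists>y. (\<tau> ^^ n) y = x \<and> norm ((C ^^ n) (\<iota> y) - t) < \<delta>)"
    by (rule eventually_mono) (blast intro: le_less_trans)
  with fr show "\<exists>\<^sub>F n in sequentially. \<exists>y. (\<tau> ^^ n) y = x \<and> norm ((C ^^ n) (\<iota> y) - t) < \<delta>"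
    by (rule frequently_rev_mp)
qed

text \<open>This is the approximation at level 0, where the only point over \<open>x\<close> is
  \<open>x\<close> itself. Compactness and local finiteness both rest on this bound.\<close>

lemma tile_near:
  assumes "t \<in> tile x"
  shows "norm (\<iota> x - t) \<le> err 0"
proof (rule field_le_epsilon)
  fix \<delta> :: real assume "\<delta> > 0"
  from tile_approx[OF assms this, of 0] show "norm (\<iota> x - t) \<le> err 0 + \<delta>" by simp
qed

lemma compact_tile: "compact (tile x)"
proof -
  have "tile x \<subseteq> cball (\<iota> x) (err 0)" using tile_near by (auto simp: dist_norm)
  hence "bounded (tile x)" by (rule bounded_subset[OF bounded_cball])
  thus ?thesis by (simp add: compact_eq_bounded_closed tile_def closed_lower_limit)
qed

section \<open>Local finiteness, covering and subdivision\<close>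

lemma finite_near: "finite {z. norm (\<iota> z - t) \<le> R}"
proof (rule finite_subset[OF _ discrete[of "R + norm t"]])
  show "{z. norm (\<iota> z - t) \<le> R} \<subseteq> {z. norm (\<iota> z) \<le> R + norm t}"
  proof clarify
    fix z assume "norm (\<iota> z - t) \<le> R"
    with norm_triangle_sub[of "\<iota> z" t] show "norm (\<iota> z) \<le> R + norm t" by linarith
  qed
qed

lemma locally_finite_tile: "locally_finite_family UNIV tile"
  unfolding locally_finite_family_def
proof (intro allI)
  fix u :: 'a and r :: real
  have "{x \<in> UNIV. ball u r \<inter> tile x \<noteq> {}} \<subseteq> {x. norm (\<iota> x - u) \<le> err 0 + r}"
  proof clarsimp
    fix x assume "ball u r \<inter> tile x \<noteq> {}"
    then obtain t where t: "norm (u - t) < r" "t \<in> tile x" by (auto simp: dist_norm)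
    from norm_triangle_mono[OF tile_near[OF t(2)] less_imp_le[OF t(1)[unfolded norm_minus_commute[of u]]]]
    show "norm (\<iota> x - u) \<le> err 0 + r" by simp
  qed
  thus "finite {x \<in> UNIV. ball u r \<inter> tile x \<noteq> {}}" using finite_near finite_subset by blast
qed

lemma finite_at: "finite {x. t \<in> tile x}"
proof (rule finite_subset)
  have "t \<in> ball t 1" by simp
  thus "{x. t \<in> tile x} \<subseteq> {x \<in> UNIV. ball t 1 \<inter> tile x \<noteq> {}}" by blast
  show "finite {x \<in> UNIV. ball t 1 \<inter> tile x \<noteq> {}}"
    using locally_finite_tile unfolding locally_finite_family_def by blast
qed

text \<open>Level \<open>n\<close> has a point within \<open>onorm (C ^^ n) * R\<close> of
  \<open>t\<close>, and the labels \<open>(\<tau> ^^ n) (z n)\<close> of these points stay in a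
  bounded, hence finite, set. A label that recurs infinitely often belongs to a tile containing
  \<open>t\<close>.\<close>

lemma tile_cover: "\<exists>x. t \<in> tile x"
proof -
  \<comment> \<open>At \<open>n = 0\<close> quasi-periodicity yields that the points
    \<open>\<iota> z\<close> are relatively dense.\<close>
  obtain R where R: "\<And>t. \<exists>z. norm (\<iota> z - t) \<le> R" using quasi_periodic[of 0] by blast
  have "\<exists>z. norm ((C ^^ n) (\<iota> z) - t) \<le> onorm (C ^^ n) * R" for n
  proof -
    obtain s where s: "t = (C ^^ n) s" using surj_pow by (metis surjD)
    obtain z where "norm (\<iota> z - s) \<le> R" using R by blast
    hence "norm ((C ^^ n) (\<iota> z - s)) \<le> onorm (C ^^ n) * R"
      by (intro order_trans[OF norm_pow_le] mult_left_mono onorm_pow_nonneg)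
    thus ?thesis unfolding s pow_diff by blast
  qed
  then obtain z where z: "\<And>n. norm ((C ^^ n) (\<iota> (z n)) - t) \<le> onorm (C ^^ n) * R" by metis
  have lim: "(\<lambda>n. onorm (C ^^ n) * R) \<longlonglongrightarrow> 0" by (intro tendsto_mult_left_zero onorm_pow_tendsto)
  obtain K where K: "\<And>n. norm (onorm (C ^^ n) * R) \<le> K"
    using convergent_imp_Bseq[OF convergentI[OF lim]] unfolding Bseq_def by blast
  have "(\<tau> ^^ n) (z n) \<in> {x. norm (\<iota> x - t) \<le> err 0 + K}" for n
    using norm_triangle_mono[OF dist_backward_le[of 0 n "z n"] order_trans[OF z[of n] order_trans[OF _ K[of n]]]]
    by simp
  from frequently_constant[where g = "\<lambda>n. (\<tau> ^^ n) (z n)", OF finite_near this] obtain x where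
    "\<exists>\<^sub>F n in sequentially. (\<tau> ^^ n) (z n) = x" by blast
  hence "\<exists>\<^sub>F n in sequentially. \<exists>y. (\<tau> ^^ n) y = x \<and> norm ((C ^^ n) (\<iota> y) - t) \<le> onorm (C ^^ n) * R"
    by (rule frequently_elim1) (use z in blast)
  from tileI_tendsto[OF lim this] show ?thesis by blast
qed

text \<open>Undoing one \<open>C\<close> turns an approximation of \<open>t\<close> at level
  \<open>Suc k\<close> into one of \<open>s\<close> at level \<open>k\<close>, lying over some
  preimage of \<open>x\<close>. The preimages that occur form a finite set, so one of them serves
  infinitely many levels.\<close>

lemma tile_subdivision:
  assumes "t \<in> tile x"
  shows "\<exists>y s. \<tau> y = x \<and> s \<in> tile y \<and> t = C s"
proof -
  obtain s where s: "t = C s"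
    using surjD[OF surj_pow[of 1]] by auto
  obtain B where B: "B > 0" "\<And>v. B * norm v \<le> norm (C v)"
    using linear_inj_bounded_below_pos[OF linear_C inj_C] by blast
  define K where "K = 1 / B"
  have K: "K > 0" "\<And>v. norm v \<le> K * norm (C v)"
    using B by (auto simp: K_def field_simps)
  \<comment> \<open>\<open>K\<close> bounds the inverse of \<open>C\<close>, and
    \<open>1 / Suc k\<close> is the positive slack that \<open>tile_approx\<close> asks for.\<close>
  define f where "f k = K * (err (Suc k) + 1 / Suc k)" for k
  have f: "f \<longlonglongrightarrow> 0"
  proof -
    have "(\<lambda>k. K * (err (Suc k) + 1 / Suc k)) \<longlonglongrightarrow> K * (0 + 0)"
      by (intro tendsto_intros LIMSEQ_Suc[OF err_tendsto] LIMSEQ_Suc[OF lim_1_over_n])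
    thus ?thesis by (simp add: f_def[abs_def])
  qed
  have "\<exists>y. \<tau> ((\<tau> ^^ k) y) = x \<and> norm ((C ^^ k) (\<iota> y) - s) \<le> f k" for k
  proof -
    obtain y where y: "(\<tau> ^^ Suc k) y = x" "norm ((C ^^ Suc k) (\<iota> y) - t) < err (Suc k) + 1 / Suc k"
      using tile_approx[OF assms, of "1 / Suc k" "Suc k"] by auto
    have "norm ((C ^^ k) (\<iota> y) - s) \<le> K * norm (C ((C ^^ k) (\<iota> y) - s))" by (rule K)
    also have "\<dots> \<le> f k"
      unfolding f_def using y(2) K(1) by (simp add: s linear_diff[OF linear_C])
    finally show ?thesis using y(1) by auto
  qed
  then obtain y where y: "\<And>k. \<tau> ((\<tau> ^^ k) (y k)) = x" "\<And>k. norm ((C ^^ k) (\<iota> (y k)) - s) \<le> f k"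
    by metis
  obtain K' where K': "\<And>n. norm (f n) \<le> K'"
    using convergent_imp_Bseq[OF convergentI[OF f]] unfolding Bseq_def by blast
  have "(\<tau> ^^ n) (y n) \<in> {x. norm (\<iota> x - s) \<le> err 0 + K'}" for n
    using norm_triangle_mono[OF dist_backward_le[of 0 n "y n"] order_trans[OF y(2)[of n] order_trans[OF _ K'[of n]]]]
    by simp
  from frequently_constant[where g = "\<lambda>n. (\<tau> ^^ n) (y n)", OF finite_near this] obtain z where
    z: "\<exists>\<^sub>F n in sequentially. (\<tau> ^^ n) (y n) = z" by blast
  hence "\<tau> z = x" using y(1) frequently_ex by blast
  moreover have "\<exists>\<^sub>F n in sequentially. \<exists>y. (\<tau> ^^ n) y = z \<and> norm ((C ^^ n) (\<iota> y) - s) \<le> f n"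
    using z by (rule frequently_elim1) (use y in blast)
  from tileI_tendsto[OF f this] have "s \<in> tile z" .
  ultimately show ?thesis using s by blast
qed

lemma tile_subdivision_pow:
  assumes "(C ^^ n) s \<in> tile x"
  shows "\<exists>y. (\<tau> ^^ n) y = x \<and> s \<in> tile y"
  using assms
proof (induction n arbitrary: x)
  case 0
  thus ?case by auto
next
  case (Suc n)
  from tile_subdivision[OF Suc.prems] obtain y u where y: "\<tau> y = x" "u \<in> tile y" "C ((C ^^ n) s) = C u"
    by auto
  with inj_C have "(C ^^ n) s \<in> tile y" by (auto simp: inj_def)
  from Suc.IH[OF this] y(1) show ?case by auto
qed

text \<open>Converse of \<open>tile_approx\<close>. The ancestors \<open>z k\<close> of
  \<open>y\<close> are chosen separately for each \<open>k\<close> and need not form one backward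
  orbit; their points stay in a compact ball, and a limit point of them is the required
  \<open>s\<close>.\<close>

lemma tile_near_approx:
  assumes "(\<tau> ^^ n) y = x"
  shows "\<exists>s \<in> tile x. norm (s - (C ^^ n) (\<iota> y)) \<le> err n"
proof -
  define z where "z k = inv_into UNIV (\<tau> ^^ k) y" for k
  have z: "(\<tau> ^^ k) (z k) = y" for k
    unfolding z_def by (rule surj_f_inv_f[OF surj_tau_pow])
  define p where "p k = (C ^^ (n + k)) (\<iota> (z k))" for k
  have near: "norm (p k - (C ^^ n) (\<iota> y)) \<le> err n" for k
    using dist_backward_le[of n k "z k"] by (simp add: p_def z norm_minus_commute)
  hence "\<And>k. p k \<in> cball ((C ^^ n) (\<iota> y)) (err n)" by (simp add: dist_norm norm_minus_commute)
  from compact_cball[unfolded compact_def, rule_format, of p, OF this] obtain s r where s: "s \<in> cball ((C ^^ n) (\<iota> y)) (err n)" "strict_mono r" "(p \<circ> r) \<longlonglongrightarrow> s"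
    by blast
  have "s \<in> tile x"
  proof (rule tileI)
    fix \<delta> :: real assume "\<delta> > 0"
    with s(3) obtain K where K: "\<And>k. k \<ge> K \<Longrightarrow> norm (p (r k) - s) < \<delta>"
      unfolding LIMSEQ_iff by auto
    show "\<exists>\<^sub>F n in sequentially. \<exists>y. (\<tau> ^^ n) y = x \<and> norm ((C ^^ n) (\<iota> y) - s) < \<delta>"
      unfolding frequently_sequentially
    proof
      fix N
      define k where "k = max K N"
      have "n + r k \<ge> N" using seq_suble[OF s(2), of k] by (simp add: k_def)
      moreover have "(\<tau> ^^ (n + r k)) (z (r k)) = x" by (simp add: funpow_add z assms)
      moreover have "norm ((C ^^ (n + r k)) (\<iota> (z (r k))) - s) < \<delta>"
        using K[of k] by (simp add: p_def k_def)
      ultimately show "\<exists>m\<ge>N. \<exists>y. (\<tau> ^^ m) y = x \<and> norm ((C ^^ m) (\<iota> y) - s) < \<delta>" by blast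
    qed
  qed
  thus ?thesis using s(1) by (auto simp: dist_norm norm_minus_commute)
qed

text \<open>Subtracting \<open>w\<close> from a level \<open>n\<close> point shifts both its
  position and its label by the same \<open>w'\<close>. Passing from the tile to level
  \<open>n\<close> and back costs \<open>err n\<close> each time, whence the factor 2.\<close>

lemma tile_shift:
  assumes w: "\<iota> w' = (C ^^ n) (\<iota> w)" "\<And>z. (\<tau> ^^ n) (z + w) = (\<tau> ^^ n) z + w'"
    and t: "t + \<iota> w' \<in> tile x" and e: "2 * err n < \<epsilon>"
  shows "\<exists>s \<in> tile (x - w'). s \<in> ball t \<epsilon>"
proof -
  obtain y where y: "(\<tau> ^^ n) y = x" "norm ((C ^^ n) (\<iota> y) - (t + \<iota> w')) < err n + (\<epsilon> - 2 * err n)"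
    using tile_approx[OF t, of "\<epsilon> - 2 * err n" n] e by auto
  have "(\<tau> ^^ n) (y - w) + w' = x" using w(2)[of "y - w"] y(1) by simp
  hence "(\<tau> ^^ n) (y - w) = x - w'" by (simp add: eq_diff_eq)
  from tile_near_approx[OF this] obtain s where
    s: "s \<in> tile (x - w')" "norm (s - (C ^^ n) (\<iota> (y - w))) \<le> err n" by blast
  have "\<iota> y = \<iota> (y - w) + \<iota> w" using iota_add[of "y - w" w] by simp
  hence "(C ^^ n) (\<iota> y) = (C ^^ n) (\<iota> (y - w)) + \<iota> w'"
    by (simp add: w(1) linear_add[OF linear_pow])
  with y(2) have "norm ((C ^^ n) (\<iota> (y - w)) - t) < \<epsilon> - err n" by (simp add: algebra_simps)
  with s(2) norm_triangle_ineq[of "s - (C ^^ n) (\<iota> (y - w))" "(C ^^ n) (\<iota> (y - w)) - t"]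
  have "norm (s - t) < \<epsilon>" by simp
  with s(1) show ?thesis by (auto simp: dist_norm norm_minus_commute)
qed

text \<open>By local finiteness only finitely many tiles near \<open>t\<close> miss
  \<open>t\<close>, and their union is closed.\<close>

lemma exclusive_neighbourhood:
  "\<exists>\<epsilon>>0. \<forall>x s. s \<in> tile x \<longrightarrow> s \<in> ball t \<epsilon> \<longrightarrow> t \<in> tile x"
proof -
  define F where "F = {x. ball t 1 \<inter> tile x \<noteq> {} \<and> t \<notin> tile x}"
  have "finite {x \<in> UNIV. ball t 1 \<inter> tile x \<noteq> {}}"
    using locally_finite_tile unfolding locally_finite_family_def by blast
  hence "finite F" by (rule finite_subset[rotated]) (auto simp: F_def)
  hence "closed (\<Union>x\<in>F. tile x)" by (intro closed_UN compact_imp_closed compact_tile ballI)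
  moreover have "t \<notin> (\<Union>x\<in>F. tile x)" by (auto simp: F_def)
  ultimately obtain r where r: "r > 0" "ball t r \<subseteq> - (\<Union>x\<in>F. tile x)"
    using openE[of "- (\<Union>x\<in>F. tile x)" t] by (auto simp: closed_def)
  have "t \<in> tile x" if "s \<in> tile x" "s \<in> ball t (min r 1)" for x s
  proof (rule ccontr)
    assume "t \<notin> tile x"
    moreover from that have "ball t 1 \<inter> tile x \<noteq> {}" by auto
    ultimately have "x \<in> F" by (simp add: F_def)
    moreover have "s \<in> ball t r" using that by simp
    ultimately show False using r(2) that(1) by blast
  qed
  with r(1) show ?thesis by (intro exI[of _ "min r 1"]) auto
qed

section \<open>Covering degree and the tiling property\<close>

lemma covering_degree_at_pos: "1 \<le> covering_degree_at UNIV tile t"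
  using tile_cover[of t] finite_at[of t] unfolding covering_degree_at_def
  by (simp add: Suc_le_eq card_gt_0_iff)

lemma covering_degree_attained:
  "\<exists>t. covering_degree_at UNIV tile t = covering_degree UNIV tile"
proof -
  have "Inf (range (covering_degree_at UNIV tile)) \<in> range (covering_degree_at UNIV tile)"
    by (rule Inf_nat_def1) simp
  thus ?thesis unfolding covering_degree_def by (metis imageE)
qed

text \<open>Suppose \<open>s\<close> is interior to one tile too many. Blown up by the inverse of
  \<open>C ^^ N\<close>, a ball around \<open>s\<close> becomes large enough to contain a translate
  \<open>u\<close> of a point \<open>t\<close> of minimal degree. Subdivision puts \<open>u\<close>
  into equally many distinct tiles, and shifting back puts their translates among the tiles at
  \<open>t\<close>.\<close>

lemma weak_m_tiling_tile:
  "weak_m_tiling (covering_degree UNIV tile) UNIV tile" "covering_degree UNIV tile \<ge> 1"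
proof -
  obtain t where t: "covering_degree_at UNIV tile t = covering_degree UNIV tile"
    using covering_degree_attained by blast
  define S where "S = {x. t \<in> tile x}"
  have S: "finite S" "card S = covering_degree UNIV tile"
    using finite_at t by (auto simp: S_def covering_degree_at_def)
  obtain \<epsilon> where \<epsilon>: "\<epsilon> > 0" "\<And>x s. s \<in> tile x \<Longrightarrow> s \<in> ball t \<epsilon> \<Longrightarrow> x \<in> S"
    using exclusive_neighbourhood[of t] by (auto simp: S_def)
  have "(\<Inter>y\<in>J. interior (tile y)) = {}" if J: "card J = covering_degree UNIV tile + 1" for J
  proof (rule ccontr)
    assume "(\<Inter>y\<in>J. interior (tile y)) \<noteq> {}"
    then obtain s where s: "\<And>y. y \<in> J \<Longrightarrow> s \<in> interior (tile y)" by blast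
    \<comment> \<open>An infinite set has \<open>card\<close> 0, so positive cardinality forces
      finiteness.\<close>
    have fin: "finite J" using J by (metis Suc_eq_plus1 card.infinite nat.distinct(1))
    hence "open (\<Inter>y\<in>J. interior (tile y))" by auto
    with s obtain \<delta> where \<delta>: "\<delta> > 0" "ball s \<delta> \<subseteq> (\<Inter>y\<in>J. interior (tile y))"
      using openE[of "\<Inter>y\<in>J. interior (tile y)" s] by blast
    have sub: "u \<in> tile y" if "y \<in> J" "u \<in> ball s \<delta>" for u y
      using \<delta>(2) that interior_subset by blast
    have "(\<lambda>n. 2 * err n) \<longlonglongrightarrow> 2 * 0" by (intro tendsto_mult_left err_tendsto)
    hence "\<forall>\<^sub>F n in sequentially. 2 * err n < \<epsilon>" using \<epsilon>(1) by (intro order_tendstoD) auto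
    then obtain n where n: "2 * err n < \<epsilon>" by (auto simp: eventually_sequentially)
    \<comment> \<open>The order of choices matters: \<open>n\<close> depends on
      \<open>\<epsilon>\<close>, \<open>R\<close> on \<open>n\<close>, and only then is
      \<open>N\<close> taken so large that \<open>C ^^ N\<close> shrinks radius \<open>R\<close>
      below \<open>\<delta>\<close>.\<close>
    obtain R where R: "\<And>t. \<exists>w w'. norm (\<iota> w' - t) \<le> R \<and> \<iota> w' = (C ^^ n) (\<iota> w) \<and>
          (\<forall>z. (\<tau> ^^ n) (z + w) = (\<tau> ^^ n) z + w')"
      using quasi_periodic[of n] by blast
    have "(\<lambda>n. onorm (C ^^ n) * R) \<longlonglongrightarrow> 0" by (intro tendsto_mult_left_zero onorm_pow_tendsto)
    hence "\<forall>\<^sub>F n in sequentially. onorm (C ^^ n) * R < \<delta>" using \<delta>(1) by (intro order_tendstoD)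
    then obtain N where N: "onorm (C ^^ N) * R < \<delta>" by (auto simp: eventually_sequentially)
    obtain s' where s': "s = (C ^^ N) s'" using surjD[OF surj_pow] by blast
    obtain w w' where w: "norm (\<iota> w' - (s' - t)) \<le> R" "\<iota> w' = (C ^^ n) (\<iota> w)"
      "\<And>z. (\<tau> ^^ n) (z + w) = (\<tau> ^^ n) z + w'"
      using R[of "s' - t"] by blast
    define u where "u = t + \<iota> w'"
    have "norm ((C ^^ N) (u - s')) \<le> onorm (C ^^ N) * norm (u - s')" by (rule norm_pow_le)
    also have "\<dots> \<le> onorm (C ^^ N) * R"
      using w(1) by (intro mult_left_mono onorm_pow_nonneg) (simp add: u_def algebra_simps)
    finally have "(C ^^ N) u \<in> ball s \<delta>"
      using N by (simp add: s' pow_diff dist_norm norm_minus_commute)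
    hence "\<exists>z. (\<tau> ^^ N) z = y \<and> u \<in> tile z" if "y \<in> J" for y
      using tile_subdivision_pow sub that by blast
    then obtain z where z: "\<And>y. y \<in> J \<Longrightarrow> (\<tau> ^^ N) (z y) = y" "\<And>y. y \<in> J \<Longrightarrow> u \<in> tile (z y)"
      by metis
    have "z y - w' \<in> S" if "y \<in> J" for y
      using tile_shift[OF w(2,3) z(2)[OF that, unfolded u_def] n] \<epsilon>(2) by blast
    hence "(\<lambda>y. z y - w') ` J \<subseteq> S" by blast
    \<comment> \<open>\<open>\<tau> ^^ N\<close> recovers \<open>y\<close> from \<open>z y\<close>,
      so different tiles stay different.\<close>
    moreover have "inj_on (\<lambda>y. z y - w') J"
      using z(1) by (auto intro!: inj_onI) metis
    ultimately have "card J \<le> card S" using S(1) by (intro card_inj_on_le)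
    with J S(2) show False by simp
  qed
  thus "weak_m_tiling (covering_degree UNIV tile) UNIV tile"
    using tile_cover locally_finite_tile compact_tile unfolding weak_m_tiling_def by auto
  show "covering_degree UNIV tile \<ge> 1"
    using covering_degree_at_pos[of t] t by simp
qed

text \<open>As \<open>C s = 0\<close> forces \<open>s = 0\<close>, subdivision gives every label of
  a tile at 0 a preimage under \<open>\<tau>\<close> of the same kind. A backward orbit in this
  finite set repeats, and the period is carried forward to \<open>x\<close>.\<close>

lemma purely_periodic_if_zero_in_tile:
  assumes "0 \<in> tile x"
  shows "\<exists>n>0. (\<tau> ^^ n) x = x"
proof -
  define F where "F = {x. 0 \<in> tile x}"
  have "\<exists>y\<in>F. \<tau> y = x" if "x \<in> F" for x
  proof -
    from that obtain y s where "\<tau> y = x" "s \<in> tile y" "0 = C s"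
      using tile_subdivision unfolding F_def by blast
    moreover from this have "s = 0" using inj_C linear_0[OF linear_C] by (metis injD)
    ultimately show ?thesis by (auto simp: F_def)
  qed
  then obtain g where g: "\<And>x. x \<in> F \<Longrightarrow> g x \<in> F" "\<And>x. x \<in> F \<Longrightarrow> \<tau> (g x) = x" by metis
  define y where "y k = (g ^^ k) x" for k
  have y: "y k \<in> F" for k
    using assms g(1) by (induction k) (simp_all add: y_def F_def)
  have descend: "(\<tau> ^^ k) (y (j + k)) = y j" for j k
  proof (induction k)
    case (Suc k)
    have "\<tau> (y (j + Suc k)) = y (j + k)" using g(2)[OF y[of "j + k"]] by (simp add: y_def)
    with Suc show ?case by (simp add: funpow_swap1)
  qed simp
  have "finite F" unfolding F_def by (rule finite_at)
  hence "finite (range y)" using y by (auto intro: finite_subset)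
  hence "\<not> inj y" using finite_imageD by auto
  then obtain i j where ij: "i < j" "y i = y j"
    unfolding inj_def by (metis linorder_less_linear)
  define k where "k = j - i"
  have "(\<tau> ^^ k) (y i) = y i" using descend[of k i] ij by (simp add: k_def)
  moreover have "(\<tau> ^^ i) (y i) = x" using descend[of i 0] by (simp add: y_def)
  \<comment> \<open>Powers of \<open>\<tau>\<close> commute, so the period of \<open>y i\<close>
    passes to its image \<open>x\<close>.\<close>
  ultimately have "(\<tau> ^^ k) x = x"
    by (metis (no_types, lifting) add.commute funpow_add o_apply)
  thus ?thesis using ij(1) by (intro exI[of _ k]) (simp add: k_def)
qed

text \<open>A purely periodic point whose orbit reaches the fixed point 0 is 0 itself, so the origin
  lies in at most one tile.\<close>

lemma covering_degree_le_1:
  assumes fp: "\<And>z. \<exists>n. (\<tau> ^^ n) z = 0" and "\<tau> 0 = 0"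
  shows "covering_degree UNIV tile \<le> 1"
proof -
  have "x = 0" if x: "0 \<in> tile x" for x
  proof -
    obtain n where n: "n > 0" "(\<tau> ^^ n) x = x" using purely_periodic_if_zero_in_tile[OF x] by blast
    obtain m where m: "(\<tau> ^^ m) x = 0" using fp by blast
    have zero: "(\<tau> ^^ k) 0 = 0" for k using \<open>\<tau> 0 = 0\<close> by (induction k) simp_all
    have per: "(\<tau> ^^ (n * k)) x = x" for k
      by (induction k) (simp_all add: funpow_add n(2))
    \<comment> \<open>The multiple \<open>n * m\<close> of the period lies at or past the time
      \<open>m\<close> at which the orbit has reached 0.\<close>
    have "m \<le> n * m" using n(1) by simp
    then obtain j where "n * m = j + m" using le_Suc_ex by (metis add.commute)
    hence "(\<tau> ^^ (n * m)) x = 0" using m zero by (simp add: funpow_add)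
    with per show "x = 0" by simp
  qed
  hence "{x. 0 \<in> tile x} \<subseteq> {0}" by blast
  from card_mono[OF _ this] have "covering_degree_at UNIV tile 0 \<le> 1" by (simp add: covering_degree_at_def)
  moreover have "covering_degree UNIV tile \<le> covering_degree_at UNIV tile 0"
    unfolding covering_degree_def by (rule cINF_lower) auto
  ultimately show ?thesis by linarith
qed

end

section \<open>Linear recurrences\<close>

lemma complex_poly_linear_factor:
  fixes p :: "complex poly"
  assumes "degree p > 0"
  obtains \<alpha> q where "p = [:-\<alpha>, 1:] * q" "degree q < degree p" "poly p \<alpha> = 0"
proof -
  from assms have "\<not> constant (poly p)" by (simp add: constant_degree)
  then obtain \<alpha> where \<alpha>: "poly p \<alpha> = 0" using fundamental_theorem_of_algebra by blast
  then obtain q where q: "p = [:-\<alpha>, 1:] * q" by (auto simp: poly_eq_0_iff_dvd)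
  with assms have "q \<noteq> 0" by auto
  hence "degree p = Suc (degree q)" unfolding q by (subst degree_mult_eq) auto
  with that[OF q] \<alpha> show ?thesis by simp
qed

text \<open>Up to sign the constant coefficient is the leading one times the product of the roots;
  the induction splits off one root at a time. The bound is what makes the shift radix map
  surjective.\<close>

lemma norm_lead_coeff_le_if_roots_outside:
  fixes p :: "complex poly"
  assumes "\<And>z. poly p z = 0 \<Longrightarrow> norm z > 1"
  shows "norm (Polynomial.lead_coeff p) \<le> norm (coeff p 0)"
  using assms
proof (induction "degree p" arbitrary: p rule: less_induct)
  case less
  show ?case
  proof (cases "degree p = 0")
    case False
    then obtain \<alpha> q where q: "p = [:-\<alpha>, 1:] * q" "degree q < degree p" "poly p \<alpha> = 0"
      using complex_poly_linear_factor by blast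
    have "norm (Polynomial.lead_coeff q) \<le> norm (coeff q 0)"
      using less.prems q(1) by (intro less.hyps[OF q(2)]) auto
    also have "\<dots> \<le> norm \<alpha> * norm (coeff q 0)"
      using less.prems[OF q(3)] by (simp add: mult_le_cancel_right1)
    also have "\<dots> = norm (coeff p 0)" unfolding q(1) by (simp add: coeff_mult_0 norm_mult)
    finally show ?thesis unfolding q(1) Polynomial.lead_coeff_mult by simp
  qed simp
qed

text \<open>Taking norms and summing the recurrence gives an affine inequality for the partial sums;
  \<open>K\<close> is the fixed point of that affine map.\<close>

lemma summable_norm_first_order_recurrence:
  fixes s u :: "nat \<Rightarrow> complex"
  assumes "norm l < 1" "summable (\<lambda>n. norm (u n))" "\<And>n. s (Suc n) = l * s n + u n"
  shows "summable (\<lambda>n. norm (s n))"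
proof (rule summableI_nonneg_bounded)
  define K where "K = (norm (s 0) + (\<Sum>n. norm (u n))) / (1 - norm l)"
  have K: "K = norm (s 0) + norm l * K + (\<Sum>n. norm (u n))"
    using assms(1) by (simp add: K_def field_simps)
  show "(\<Sum>n<N. norm (s n)) \<le> K" for N
  proof (induction N)
    case 0
    show ?case using assms(1,2) by (auto simp: K_def intro!: divide_nonneg_pos add_nonneg_nonneg suminf_nonneg)
  next
    case (Suc N)
    have "(\<Sum>n<Suc N. norm (s n)) = norm (s 0) + (\<Sum>n<N. norm (l * s n + u n))"
      by (simp add: sum.lessThan_Suc_shift assms(3) del: sum.lessThan_Suc)
    also have "\<dots> \<le> norm (s 0) + (\<Sum>n<N. norm l * norm (s n) + norm (u n))"
      by (intro add_left_mono sum_mono order_trans[OF norm_triangle_ineq]) (simp add: norm_mult)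
    also have "\<dots> = norm (s 0) + norm l * (\<Sum>n<N. norm (s n)) + (\<Sum>n<N. norm (u n))"
      by (simp add: sum.distrib sum_distrib_left)
    also have "\<dots> \<le> norm (s 0) + norm l * K + (\<Sum>n. norm (u n))"
      using Suc assms(2) by (intro add_mono mult_left_mono sum_le_suminf) auto
    finally show ?case using K by simp
  qed
qed simp

text \<open>Split off a root \<open>l\<close> of \<open>p\<close>: the sequence
  \<open>s (Suc n) - l * s n\<close> obeys the recurrence of the cofactor, so it is summable by
  induction, and it drives a first-order recurrence for \<open>s\<close>. This replaces spectral
  radius or Jordan form arguments.\<close>

lemma summable_norm_linear_recurrence:
  fixes p :: "complex poly" and s :: "nat \<Rightarrow> complex"
  assumes "p \<noteq> 0" "\<And>z. poly p z = 0 \<Longrightarrow> norm z < 1"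
    and "\<And>n. (\<Sum>i\<le>degree p. coeff p i * s (n + i)) = 0"
  shows "summable (\<lambda>n. norm (s n))"
  using assms
proof (induction "degree p" arbitrary: p s rule: less_induct)
  case less
  show ?case
  proof (cases "degree p = 0")
    case True
    hence "coeff p 0 \<noteq> 0" using less.prems(1) leading_coeff_0_iff by fastforce
    moreover have "coeff p 0 * s n = 0" for n using less.prems(3)[of n] True by simp
    ultimately have "s n = 0" for n by simp
    thus ?thesis by simp
  next
    case False
    then obtain l q where q: "p = [:-l, 1:] * q" "degree q < degree p" "poly p l = 0"
      using complex_poly_linear_factor by blast
    have q0: "q \<noteq> 0" using less.prems(1) q(1) by auto
    have deg: "degree p = Suc (degree q)" unfolding q(1) using q0 by (subst degree_mult_eq) auto
    define u where "u n = s (Suc n) - l * s n" for n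
    have "summable (\<lambda>n. norm (u n))"
    proof (rule less.hyps[OF q(2) q0])
      show "norm z < 1" if "poly q z = 0" for z using that less.prems(2) q(1) by simp
      fix n
      have "(\<Sum>i\<le>degree p. coeff p i * s (n + i)) =
          (\<Sum>i\<le>Suc (degree q). coeff (pCons 0 q) i * s (n + i)) - l * (\<Sum>i\<le>Suc (degree q). coeff q i * s (n + i))"
        unfolding deg by (simp add: q(1) sum_subtractf[symmetric] sum_distrib_left algebra_simps
            del: sum.atMost_Suc)
      also have "(\<Sum>i\<le>Suc (degree q). coeff (pCons 0 q) i * s (n + i)) = (\<Sum>i\<le>degree q. coeff q i * s (n + Suc i))"
        by (subst sum.atMost_Suc_shift) simp
      also have "(\<Sum>i\<le>Suc (degree q). coeff q i * s (n + i)) = (\<Sum>i\<le>degree q. coeff q i * s (n + i))"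
        by (simp add: coeff_eq_0)
      finally show "(\<Sum>i\<le>degree q. coeff q i * u (n + i)) = 0"
        using less.prems(3)[of n] by (simp add: u_def sum_distrib_left sum_subtractf[symmetric] algebra_simps)
    qed
    from summable_norm_first_order_recurrence[OF less.prems(2)[OF q(3)] this]
    show ?thesis by (simp add: u_def)
  qed
qed

lemma onorm_le_sum_Basis:
  fixes f :: "'a::euclidean_space \<Rightarrow> 'b::real_normed_vector"
  assumes "linear f"
  shows "onorm f \<le> (\<Sum>b\<in>Basis. norm (f b))"
proof (rule onorm_le)
  fix x :: 'a
  have "f x = (\<Sum>b\<in>Basis. (x \<bullet> b) *\<^sub>R f b)"
    by (subst euclidean_representation[of x, symmetric]) (simp add: linear_sum[OF assms] linear_cmul[OF assms] del: euclidean_representation)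
  also have "norm \<dots> \<le> (\<Sum>b\<in>Basis. norm (f b) * norm x)"
    by (intro order_trans[OF norm_sum] sum_mono) (simp add: Basis_le_norm mult.commute[of _ "norm x"] mult_right_mono)
  finally show "norm (f x) \<le> (\<Sum>b\<in>Basis. norm (f b)) * norm x" by (simp add: sum_distrib_right)
qed

text \<open>The operator norm is at most the sum of the norms of the images of the finitely many
  basis vectors, so pointwise summability suffices.\<close>

lemma summable_onorm_funpow:
  fixes f :: "'a::euclidean_space \<Rightarrow> 'a"
  assumes "\<And>n. linear (f ^^ n)" "\<And>v. summable (\<lambda>n. norm ((f ^^ n) v))"
  shows "summable (\<lambda>n. onorm (f ^^ n))"
proof (rule summable_comparison_test')
  show "summable (\<lambda>n. \<Sum>b\<in>Basis. norm ((f ^^ n) b))" by (intro summable_sum assms(2))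
  show "norm (onorm (f ^^ n)) \<le> (\<Sum>b\<in>Basis. norm ((f ^^ n) b))" if "n \<ge> 0" for n
    using onorm_le_sum_Basis[OF assms(1)] assms(1)[of n]
    by (simp add: onorm_pos_le linear_conv_bounded_linear)
qed

section \<open>The companion matrix\<close>

lemma matrix_inv_eqI:
  assumes "P ** P' = mat 1" "P' ** P = mat 1"
  shows "matrix_inv P = P'"
proof -
  have "P ** matrix_inv P = mat 1 \<and> matrix_inv P ** P = mat 1"
    unfolding matrix_inv_def by (rule someI[of _ P']) (use assms in blast)
  hence "matrix_inv P = matrix_inv P ** (P ** P')" "matrix_inv P ** (P ** P') = P'"
    using assms(1) by (metis matrix_mul_rid, metis matrix_mul_assoc matrix_mul_lid)
  thus ?thesis by simp
qed

lemma
  assumes "invertible P"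
  shows matrix_inv_right: "P ** matrix_inv P = mat 1"
    and matrix_inv_left: "matrix_inv P ** P = mat 1"
  using assms matrix_inv_eqI unfolding invertible_def by metis+

text \<open>The inverse of \<open>pos\<close>, meaningful only for arguments below
  \<open>CARD('n)\<close>.\<close>

definition index_at :: "nat \<Rightarrow> 'n::{finite,wellorder}" where
  "index_at = inv_into UNIV pos"

lemma pos_index_at: "k < CARD('n) \<Longrightarrow> pos (index_at k :: 'n::{finite,wellorder}) = k"
  unfolding index_at_def by (rule f_inv_into_f) (simp add: range_pos)

lemma index_at_pos [simp]: "index_at (pos i) = i"
  unfolding index_at_def by (rule inv_f_f[OF inj_pos])

lemma sum_pos: "(\<Sum>i\<in>(UNIV :: 'n::{finite,wellorder} set). f (pos i)) = (\<Sum>k<CARD('n). f k)"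
proof -
  have "sum f (range (pos :: 'n \<Rightarrow> nat)) = (\<Sum>i\<in>(UNIV :: 'n set). f (pos i))"
    by (simp add: sum.reindex[OF inj_pos])
  thus ?thesis by (simp add: range_pos)
qed

lemma M_mat_mult:
  "(M_mat r *v v) $ (i :: 'n::{finite,wellorder}) =
     (if pos i = CARD('n) - 1 then - (\<Sum>j\<in>UNIV. r (pos j) * v $ j) else v $ index_at (pos i + 1))"
proof (cases "pos i = CARD('n) - 1")
  case True
  thus ?thesis by (simp add: M_mat_def matrix_vector_mult_def sum_negf)
next
  case False
  with pos_less[of i] have "pos i + 1 < CARD('n)" by simp
  hence "pos j = pos i + 1 \<longleftrightarrow> j = index_at (pos i + 1)" for j :: 'n
    using pos_index_at by (metis index_at_pos)
  hence "(M_mat r *v v) $ i = (\<Sum>j\<in>UNIV. if j = index_at (pos i + 1) then v $ j else 0)"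
    using False unfolding M_mat_def matrix_vector_mult_def
    by (simp add: if_distrib[of "\<lambda>x. x * _"] cong: if_cong)
  thus ?thesis using False by simp
qed

lemma mat_power_mult: "mat_power P (Suc n) *v v = P *v (mat_power P n *v v)"
  by (simp add: matrix_vector_mul_assoc)

lemma mat_power_eq_funpow: "mat_power P n *v v = (((*v) P) ^^ n) v"
  by (induction n) (simp_all add: matrix_vector_mul_assoc[symmetric])

text \<open>For a kernel vector the superdiagonal rows kill every coordinate but the first, and the
  last row then kills that one because \<open>r 0\<close> is nonzero.\<close>

lemma invertible_M_mat:
  assumes "r 0 \<noteq> 0"
  shows "invertible (M_mat r :: real ^ 'n::{finite,wellorder} ^ 'n::{finite,wellorder})"
proof -
  have "v = 0" if v: "M_mat r *v v = 0" for v :: "real ^ 'n::{finite,wellorder}"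
  proof -
    have pos: "v $ i = 0" if "pos i > 0" for i
    proof -
      have *: "pos (index_at (pos i - 1) :: 'n) = pos i - 1"
        using pos_less[of i] by (intro pos_index_at) simp
      have "(M_mat r *v v) $ index_at (pos i - 1) = v $ i"
        using that pos_less[of i] unfolding M_mat_mult * by simp
      thus ?thesis using v by simp
    qed
    have last: "pos (index_at (CARD('n) - 1) :: 'n) = CARD('n) - 1" by (rule pos_index_at) simp
    have "(M_mat r *v v) $ index_at (CARD('n) - 1) = - (\<Sum>j\<in>UNIV. r (pos j) * v $ j)"
      unfolding M_mat_mult last by simp
    also have "(\<Sum>j\<in>UNIV. r (pos j) * v $ j) = (\<Sum>j\<in>{index_at 0}. r (pos j) * v $ j)"
    proof (rule sum.mono_neutral_right)
      show "\<forall>j\<in>UNIV - {index_at 0}. r (pos j) * v $ j = 0"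
        using pos by (metis DiffD2 gr0I insertI1 index_at_pos mult_zero_right)
    qed auto
    also have "\<dots> = r 0 * v $ index_at 0" by (simp add: pos_index_at)
    finally have "v $ index_at 0 = 0" using assms v by simp
    hence "v $ i = 0" for i using pos[of i] by (metis gr0I index_at_pos)
    thus ?thesis by (simp add: vec_eq_iff)
  qed
  thus ?thesis by (metis invertible_left_inverse matrix_left_invertible_ker)
qed

text \<open>The matrix is triangular with the leading coefficient of \<open>A\<close> all along its
  diagonal.\<close>

lemma invertible_V_mat:
  assumes "A \<noteq> 0"
  shows "invertible (V_mat A :: real ^ 'n::{finite,wellorder} ^ 'n::{finite,wellorder})"
proof -
  have "det (V_mat A :: real ^ 'n::{finite,wellorder} ^ 'n::{finite,wellorder}) = (\<Prod>i\<in>(UNIV :: 'n set). V_mat A $ i $ i)"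
    by (rule det_upperdiagonal) (simp add: V_mat_def)
  also have "\<dots> \<noteq> 0" using assms by (simp add: V_mat_def)
  finally show ?thesis by (simp add: invertible_det_nz)
qed

lemma degree_map_poly_of_int [simp]: "degree (map_poly of_int A :: complex poly) = degree A"
  by (rule degree_map_poly) simp

text \<open>The coordinates of the iterates are consecutive terms of one scalar sequence
  \<open>s\<close>. The last row of \<open>M_mat\<close> makes \<open>s\<close> a linear recurrence
  whose polynomial is the reversal of \<open>A\<close>; its roots are the inverses of those of
  \<open>A\<close> and so lie inside the unit disc.\<close>

lemma summable_M_mat_power:
  fixes v :: "real ^ 'n::{finite,wellorder}"
  assumes deg: "degree A = CARD('n)" and a0: "coeff A 0 \<noteq> 0" and "expanding A"
  shows "summable (\<lambda>n. norm (mat_power (M_mat (r_vec A)) n *v v))"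
proof -
  let ?M = "M_mat (r_vec A) :: real ^ 'n::{finite,wellorder} ^ 'n::{finite,wellorder}"
  define s where "s n = (mat_power ?M n *v v) $ index_at 0" for n
  have index_at: "(mat_power ?M n *v v) $ index_at k = s (n + k)" if "k < CARD('n)" for n k
    using that
  proof (induction k arbitrary: n)
    case 0
    show ?case by (simp add: s_def)
  next
    case (Suc k)
    have "(mat_power ?M (Suc n) *v v) $ index_at k = (mat_power ?M n *v v) $ index_at (Suc k)"
      using Suc.prems unfolding mat_power_mult M_mat_mult by (simp add: pos_index_at)
    with Suc.IH[of "Suc n"] Suc.prems show ?case by (simp del: mat_power.simps)
  qed
  have comp: "(mat_power ?M n *v v) $ i = s (n + pos i)" for n i
    using index_at[OF pos_less[of i], of n] by simp
  define p where "p = reflect_poly (map_poly of_int A :: complex poly)"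
  have cp: "coeff (map_poly of_int A :: complex poly) 0 \<noteq> 0" using a0 by (simp add: coeff_map_poly)
  have degp: "degree p = CARD('n)" unfolding p_def using cp deg by simp
  have "summable (\<lambda>n. norm (complex_of_real (s n)))"
  proof (rule summable_norm_linear_recurrence)
    show "p \<noteq> 0" using degp by auto
    show "norm z < 1" if z: "poly p z = 0" for z
    proof -
      have "A \<noteq> 0" using deg by auto
      hence "poly p 0 \<noteq> 0" unfolding p_def by (simp add: coeff_map_poly)
      hence z0: "z \<noteq> 0" using z by auto
      hence "poly (map_poly of_int A) (inverse z) = 0"
        using z unfolding p_def by (simp add: poly_reflect_poly_nz)
      hence "1 < norm (inverse z)" using assms(3) unfolding expanding_def by blast
      thus ?thesis by (simp add: norm_inverse one_less_inverse_iff)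
    qed
    fix n
    have "s (n + CARD('n)) = (mat_power ?M (Suc n) *v v) $ index_at (CARD('n) - 1)"
      by (subst index_at) simp_all
    also have "\<dots> = - (\<Sum>j\<in>(UNIV :: 'n set). r_vec A (pos j) * s (n + pos j))"
      unfolding mat_power_mult M_mat_mult by (simp add: pos_index_at comp)
    also have "\<dots> = - (\<Sum>k<CARD('n). r_vec A k * s (n + k))"
      by (simp add: sum_pos[where 'n = 'n and f = "\<lambda>k. r_vec A k * s (n + k)"])
    finally have "of_int (coeff A 0) * s (n + CARD('n)) + (\<Sum>k<CARD('n). of_int (coeff A (CARD('n) - k)) * s (n + k)) = 0"
      using a0 deg by (simp add: r_vec_def sum_distrib_left)
    hence "(\<Sum>k\<le>CARD('n). of_int (coeff A (CARD('n) - k)) * s (n + k)) = 0"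
      by (simp add: lessThan_Suc_atMost[symmetric])
    hence "complex_of_real (\<Sum>k\<le>CARD('n). of_int (coeff A (CARD('n) - k)) * s (n + k)) = 0" by simp
    thus "(\<Sum>k\<le>degree p. coeff p k * complex_of_real (s (n + k))) = 0"
      unfolding degp by (simp add: p_def coeff_reflect_poly coeff_map_poly deg)
  qed
  hence s: "summable (\<lambda>n. \<bar>s n\<bar>)" by simp
  show ?thesis
  proof (rule summable_comparison_test')
    show "summable (\<lambda>n. \<Sum>i\<in>UNIV. \<bar>s (n + pos (i :: 'n))\<bar>)"
      by (intro summable_sum summable_ignore_initial_segment[OF s])
    show "norm (norm (mat_power ?M n *v v)) \<le> (\<Sum>i\<in>UNIV. \<bar>s (n + pos (i :: 'n))\<bar>)" if "n \<ge> 0" for n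
      using norm_le_l1_cart[of "mat_power ?M n *v v"] by (simp add: comp)
  qed
qed

section \<open>The shift radix map of an expanding polynomial\<close>

text \<open>The parameter \<open>index_type\<close> makes the coordinate type \<open>'n\<close> part
  of the locale, so that the degree can be tied to it.\<close>

locale expanding_integer_poly =
  fixes A :: "int poly" and index_type :: "'n::{finite,wellorder} itself"
  assumes degree_A: "degree A = CARD('n)"
    and coeff_0_ge: "coeff A 0 \<ge> 2"
    and expanding_A: "expanding A"
begin

text \<open>The constant coefficient of the combination of the \<open>W\<close> polynomials with
  coefficients \<open>z\<close>. Divided by \<open>coeff A 0\<close> it is the scalar product of the
  parameter vector \<open>r\<close> with \<open>z\<close>.\<close>

definition const_term :: "int ^ 'n::{finite,wellorder} \<Rightarrow> int" where
  "const_term z = (\<Sum>j\<in>UNIV. coeff A (degree A - pos j) * z $ j)"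

definition srs :: "int ^ 'n::{finite,wellorder} \<Rightarrow> int ^ 'n::{finite,wellorder}" where
  "srs z = (\<chi> i. if pos i = CARD('n) - 1 then - (const_term z div coeff A 0) else z $ index_at (pos i + 1))"

definition emb :: "int ^ 'n::{finite,wellorder} \<Rightarrow> real ^ 'n::{finite,wellorder}" where
  "emb z = (\<chi> i. of_int (z $ i))"

abbreviation M :: "real ^ 'n::{finite,wellorder} ^ 'n::{finite,wellorder}" where
  "M \<equiv> M_mat (r_vec A)"

abbreviation V :: "real ^ 'n::{finite,wellorder} ^ 'n::{finite,wellorder}" where
  "V \<equiv> V_mat A"

abbreviation last_index :: "'n" where
  "last_index \<equiv> index_at (CARD('n) - 1)"

lemma pos_last_index: "pos last_index = CARD('n) - 1"
  by (rule pos_index_at) simp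

lemma pos_eq_last_iff: "pos i = CARD('n) - 1 \<longleftrightarrow> i = last_index"
  using pos_last_index by (metis index_at_pos)

lemma A_nonzero: "A \<noteq> 0"
  using coeff_0_ge by auto

lemma invertible_V: "invertible V"
  by (rule invertible_V_mat[OF A_nonzero])

lemma invertible_M: "invertible M"
  using A_nonzero coeff_0_ge by (intro invertible_M_mat) (simp add: r_vec_def)

lemma abs_lead_coeff_le: "\<bar>Polynomial.lead_coeff A\<bar> \<le> coeff A 0"
proof -
  have "norm (Polynomial.lead_coeff (map_poly of_int A :: complex poly)) \<le> norm (coeff (map_poly of_int A :: complex poly) 0)"
    using expanding_A unfolding expanding_def by (intro norm_lead_coeff_le_if_roots_outside) blast
  thus ?thesis using coeff_0_ge by (simp add: coeff_map_poly)
qed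

lemma matrix_inv_B: "matrix_inv (B_mat A) = V ** M ** matrix_inv V"
proof (rule matrix_inv_eqI)
  note inv = matrix_inv_left[OF invertible_V] matrix_inv_right[OF invertible_V]
    matrix_inv_left[OF invertible_M] matrix_inv_right[OF invertible_M]
  show "B_mat A ** (V ** M ** matrix_inv V) = mat 1"
    unfolding B_mat_def using inv by (metis matrix_mul_assoc matrix_mul_rid)
  show "V ** M ** matrix_inv V ** B_mat A = mat 1"
    unfolding B_mat_def using inv by (metis matrix_mul_assoc matrix_mul_rid)
qed

text \<open>\<open>V\<close> conjugates \<open>M\<close> to the inverse of \<open>B_mat A\<close>,
  so Brunotte tiles can be studied through orbits of \<open>M\<close>.\<close>

lemma matrix_inv_B_V: "matrix_inv (B_mat A) *v (V *v w) = V *v (M *v w)"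
proof -
  have "matrix_inv V *v (V *v w) = w"
    by (simp add: matrix_vector_mul_assoc matrix_inv_left[OF invertible_V])
  thus ?thesis by (simp add: matrix_inv_B matrix_vector_mul_assoc[symmetric])
qed

lemma matrix_inv_B_pow_V: "(((*v) (matrix_inv (B_mat A))) ^^ n) (V *v w) = V *v ((((*v) M) ^^ n) w)"
  by (induction n) (simp_all add: matrix_inv_B_V)

lemma emb_nth [simp]: "emb z $ i = of_int (z $ i)"
  by (simp add: emb_def)

lemma emb_add: "emb (y + z) = emb y + emb z"
  by (simp add: vec_eq_iff)

lemma M_emb: "(M *v emb z) $ i =
  (if pos i = CARD('n) - 1 then - (of_int (const_term z) / of_int (coeff A 0)) else of_int (z $ index_at (pos i + 1)))"
  by (simp add: M_mat_mult const_term_def r_vec_def sum_divide_distrib)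

text \<open>Rounding affects the last coordinate only, and there by a fractional part
  \<open>e\<close>.\<close>

lemma srs_near: "norm (emb (srs z) - M *v emb z) \<le> 1"
proof -
  define e where "e = of_int (const_term z) / of_int (coeff A 0) - real_of_int (const_term z div coeff A 0)"
  have "emb (srs z) - M *v emb z = e *\<^sub>R axis last_index 1"
    by (simp add: vec_eq_iff srs_def M_emb e_def axis_def pos_eq_last_iff del: One_nat_def)
  moreover have "0 \<le> e" "e \<le> 1"
    unfolding e_def floor_divide_of_int_eq[where 'a = real, symmetric] by linarith+
  ultimately show ?thesis by simp
qed

lemma srs_exact: "emb (srs z) = M *v emb z" if "coeff A 0 dvd const_term z"
  unfolding vec_eq_iff
  using real_of_int_div[OF that] by (simp add: srs_def M_emb)

section \<open>Translations compatible with iterates of the shift radix map, and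
  surjectivity\<close>

lemma const_term_add: "const_term (y + z) = const_term y + const_term z"
  by (simp add: const_term_def sum.distrib algebra_simps)

lemma const_term_scale: "const_term (k *s z) = k * const_term z"
  by (simp add: const_term_def sum_distrib_left algebra_simps)

lemma srs_shift: "srs (z + coeff A 0 *s v) = srs z + srs (coeff A 0 *s v)"
  using coeff_0_ge by (simp add: vec_eq_iff srs_def const_term_add const_term_scale)

lemma srs_scale: "srs (coeff A 0 *s (k *s v)) = k *s srs (coeff A 0 *s v)"
  using coeff_0_ge by (simp add: vec_eq_iff srs_def const_term_scale mult.left_commute)

text \<open>Each application of \<open>srs\<close> spends one factor \<open>coeff A 0\<close>: it
  sends the multiple of \<open>coeff A 0 ^ Suc n\<close> without rounding, just as \<open>M\<close>
  does, to a multiple of \<open>coeff A 0 ^ n\<close>. So \<open>n\<close> factors pay for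
  \<open>n\<close> steps.\<close>

lemma srs_pow_shift:
  "\<exists>w'. emb w' = (((*v) M) ^^ n) (emb (coeff A 0 ^ n *s v)) \<and>
     (\<forall>z. (srs ^^ n) (z + coeff A 0 ^ n *s v) = (srs ^^ n) z + w')"
proof (induction n arbitrary: v)
  case 0
  show ?case by auto
next
  case (Suc n)
  let ?a = "coeff A 0"
  define u where "u = srs (?a *s v)"
  have u: "srs (?a ^ Suc n *s v) = ?a ^ n *s u"
    using srs_scale[of "?a ^ n" v] by (simp add: u_def mult.commute)
  have "emb (?a ^ n *s u) = M *v emb (?a ^ Suc n *s v)"
    unfolding u[symmetric] by (rule srs_exact) (simp add: const_term_scale)
  moreover from Suc.IH[of u] obtain w' where w':
    "emb w' = (((*v) M) ^^ n) (emb (?a ^ n *s u))"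
    "\<And>z. (srs ^^ n) (z + ?a ^ n *s u) = (srs ^^ n) z + w'" by blast
  moreover have "srs (z + ?a ^ Suc n *s v) = srs z + ?a ^ n *s u" for z
    using srs_shift[of z "?a ^ n *s v"] u by simp
  ultimately show ?case by (intro exI[of _ w']) (simp add: funpow_swap1 del: power_Suc)
qed

text \<open>All coordinates of a preimage except the first are prescribed by \<open>x\<close>. The
  first has to bring the constant term into a given interval of length \<open>coeff A 0\<close>; it
  moves the constant term in steps of \<open>\<bar>k\<bar>\<close>, which are at most that
  long.\<close>

lemma surj_srs: "surj srs"
  unfolding surj_def
proof
  fix x :: "int ^ 'n::{finite,wellorder}"
  define k where "k = Polynomial.lead_coeff A"
  have k: "k \<noteq> 0" "\<bar>k\<bar> \<le> coeff A 0" using A_nonzero abs_lead_coeff_le by (auto simp: k_def)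
  \<comment> \<open>The prescribed part of the constant term, corrected by the wanted last
    coordinate. The first coordinate of \<open>y\<close> reduces \<open>c\<close> modulo
    \<open>\<bar>k\<bar>\<close>, leaving a remainder below \<open>coeff A 0\<close> whose quotient
    is 0.\<close>
  define c where "c = (\<Sum>j\<in>UNIV - {index_at 0 :: 'n}. coeff A (degree A - pos j) * x $ index_at (pos j - 1)) + coeff A 0 * x $ last_index"
  define y :: "int ^ 'n::{finite,wellorder}" where "y = (\<chi> i. if pos i = 0 then - (sgn k * (c div \<bar>k\<bar>)) else x $ index_at (pos i - 1))"
  have pos0: "pos (index_at 0 :: 'n) = 0" by (rule pos_index_at) simp
  hence nz: "pos j \<noteq> 0" if "j \<noteq> index_at 0" for j :: 'n
    using that by (metis index_at_pos)
  have "const_term y = coeff A (degree A - pos (index_at 0 :: 'n)) * y $ index_at 0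
      + (\<Sum>j\<in>UNIV - {index_at 0 :: 'n}. coeff A (degree A - pos j) * y $ j)"
    unfolding const_term_def by (rule sum.remove) auto
  also have "(\<Sum>j\<in>UNIV - {index_at 0 :: 'n}. coeff A (degree A - pos j) * y $ j)
      = (\<Sum>j\<in>UNIV - {index_at 0 :: 'n}. coeff A (degree A - pos j) * x $ index_at (pos j - 1))"
    by (intro sum.cong) (auto simp: y_def dest: nz)
  also have "\<dots> = c - coeff A 0 * x $ last_index" by (simp add: c_def)
  also have "coeff A (degree A - pos (index_at 0 :: 'n)) * y $ index_at 0 = - (\<bar>k\<bar> * (c div \<bar>k\<bar>))"
    by (simp add: pos0 y_def k_def abs_sgn mult.assoc)
  finally have "const_term y = c mod \<bar>k\<bar> + coeff A 0 * (- x $ last_index)"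
    by (simp add: minus_mult_div_eq_mod[symmetric])
  moreover have "(c mod \<bar>k\<bar>) div coeff A 0 = 0"
    using k by (intro div_pos_pos_trivial) (auto intro: less_le_trans[OF pos_mod_bound])
  moreover have "(c mod \<bar>k\<bar> + coeff A 0 * (- x $ last_index)) div coeff A 0 = - x $ last_index + c mod \<bar>k\<bar> div coeff A 0"
    using coeff_0_ge by (intro div_mult_self2) simp
  ultimately have "const_term y div coeff A 0 = - x $ last_index" by simp
  moreover have "y $ index_at (pos i + 1) = x $ i" if "pos i \<noteq> CARD('n) - 1" for i
  proof -
    have "pos (index_at (pos i + 1) :: 'n) = pos i + 1"
      using that pos_less[of i] by (intro pos_index_at) simp
    thus ?thesis by (simp add: y_def)
  qed
  moreover have "i = last_index" if "pos i = CARD('n) - 1" for i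
    using that pos_eq_last_iff by blast
  ultimately have "srs y = x" by (auto simp: vec_eq_iff srs_def)
  thus "\<exists>y. x = srs y" by blast
qed

end

section \<open>The shift radix map as a contracting radix system\<close>

lemma finite_int_vec_bounded: "finite {z :: int ^ 'n. \<forall>i. \<bar>z $ i\<bar> \<le> k}"
proof (rule finite_subset)
  show "{z :: int ^ 'n. \<forall>i. \<bar>z $ i\<bar> \<le> k} \<subseteq> vec_lambda ` (UNIV \<rightarrow>\<^sub>E {-k..k})"
  proof clarify
    fix z :: "int ^ 'n" assume "\<forall>i. \<bar>z $ i\<bar> \<le> k"
    hence "vec_nth z \<in> UNIV \<rightarrow>\<^sub>E {-k..k}" by (auto simp: abs_le_iff minus_le_iff)
    thus "z \<in> vec_lambda ` (UNIV \<rightarrow>\<^sub>E {-k..k})" by (metis image_eqI vec_lambda_eta)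
  qed
  show "finite (vec_lambda ` (UNIV \<rightarrow>\<^sub>E {-k..k}) :: (int ^ 'n) set)"
    by (intro finite_imageI finite_PiE) auto
qed

lemma surj_matrix_vector_mult:
  fixes P :: "real ^ 'n ^ 'n"
  assumes "invertible P"
  shows "surj ((*v) P)"
  using inj_matrix_vector_mult[OF assms] linear_injective_imp_surjective[of "(*v) P"] by simp

lemma onorm_matrix:
  fixes P :: "real ^ 'n ^ 'm"
  shows "norm (P *v v) \<le> onorm ((*v) P) * norm v"
  by (rule onorm) (rule matrix_vector_mul_bounded_linear)

context expanding_integer_poly
begin

lemma linear_mult_funpow: "linear (((*v) P) ^^ n)" for P :: "real ^ 'n::{finite,wellorder} ^ 'n::{finite,wellorder}"
  unfolding mat_power_eq_funpow[symmetric, abs_def] by (rule matrix_vector_mul_linear)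

lemma summable_matrix_inv_B: "summable (\<lambda>n. onorm ((*v) (matrix_inv (B_mat A) :: real ^ 'n::{finite,wellorder} ^ 'n::{finite,wellorder}) ^^ n))"
proof (rule summable_onorm_funpow[OF linear_mult_funpow])
  fix v :: "real ^ 'n::{finite,wellorder}"
  obtain w where w: "v = V *v w" using surjD[OF surj_matrix_vector_mult[OF invertible_V]] by blast
  show "summable (\<lambda>n. norm (((*v) (matrix_inv (B_mat A)) ^^ n) v))"
    unfolding w matrix_inv_B_pow_V
  proof (rule summable_comparison_test')
    show "summable (\<lambda>n. onorm ((*v) V) * norm (((*v) M ^^ n) w))"
      using summable_M_mat_power[OF degree_A _ expanding_A, of w] coeff_0_ge
      by (intro summable_mult) (simp add: mat_power_eq_funpow)
    show "norm (norm (V *v ((*v) M ^^ n) w)) \<le> onorm ((*v) V) * norm (((*v) M ^^ n) w)" if "n \<ge> 0" for n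
      using onorm_matrix by simp
  qed
qed

lemma finite_bounded_emb: "finite {z. norm (V *v emb z) \<le> R}"
proof -
  obtain b where b: "b > 0" "\<And>v. b * norm v \<le> norm (V *v v)"
    using linear_inj_bounded_below_pos[OF matrix_vector_mul_linear inj_matrix_vector_mult[OF invertible_V]] by blast
  have "{z. norm (V *v emb z) \<le> R} \<subseteq> {z. \<forall>i. \<bar>z $ i\<bar> \<le> \<lfloor>R / b\<rfloor>}"
  proof clarify
    fix z i assume "norm (V *v emb z) \<le> R"
    with b(2)[of "emb z"] have "norm (emb z) * b \<le> R" by (simp add: mult.commute)
    hence "norm (emb z) \<le> R / b" using b(1) by (simp add: pos_le_divide_eq)
    with component_le_norm_cart[of "emb z" i] have "real_of_int \<bar>z $ i\<bar> \<le> R / b" by simp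
    thus "\<bar>z $ i\<bar> \<le> \<lfloor>R / b\<rfloor>" by (simp add: le_floor_iff)
  qed
  thus ?thesis using finite_int_vec_bounded finite_subset by blast
qed

text \<open>The admissible \<open>w\<close> are the multiples of \<open>coeff A 0 ^ n\<close>. They
  form a full lattice, and its image under the surjective \<open>P\<close> is relatively
  dense.\<close>

lemma quasi_periodic_srs:
  "\<exists>R. \<forall>t. \<exists>w w'. norm (V *v emb w' - t) \<le> R
      \<and> V *v emb w' = ((*v) (matrix_inv (B_mat A)) ^^ n) (V *v emb w)
      \<and> (\<forall>z. (srs ^^ n) (z + w) = (srs ^^ n) z + w')"
proof -
  define P where "P = V ** mat_power M n"
  define a where "a = real_of_int (coeff A 0 ^ n)"
  have a: "a > 0" using coeff_0_ge by (simp add: a_def)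
  have P: "V *v (((*v) M) ^^ n) u = P *v u" for u
    by (simp add: P_def mat_power_eq_funpow[symmetric] matrix_vector_mul_assoc)
  have "surj (((*v) M) ^^ n)" by (rule surj_fn[OF surj_matrix_vector_mult[OF invertible_M]])
  hence surj: "\<exists>u. t = P *v u" for t
    using surj_matrix_vector_mult[OF invertible_V] P by (metis surjD)
  show ?thesis
  proof (intro exI[of _ "onorm ((*v) P) * (\<Sum>i\<in>(UNIV :: 'n set). a)"] allI)
    fix t
    obtain u where u: "t = P *v u" using surj by blast
    \<comment> \<open>Rounds each coordinate of the preimage \<open>u\<close> of \<open>t\<close>
      down to a multiple of \<open>a\<close>.\<close>
    define v where "v = (\<chi> i. \<lfloor>u $ i / a\<rfloor>)"
    define w where "w = coeff A 0 ^ n *s v"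
    have "\<bar>(emb w - u) $ i\<bar> \<le> a" for i
    proof -
      have "(emb w - u) $ i = a * (of_int \<lfloor>u $ i / a\<rfloor> - u $ i / a)"
      proof -
        have "(emb w - u) $ i = a * of_int \<lfloor>u $ i / a\<rfloor> - u $ i" by (simp add: w_def v_def a_def)
        thus ?thesis using a by (simp add: right_diff_distrib)
      qed
      moreover have "\<bar>of_int \<lfloor>u $ i / a\<rfloor> - u $ i / a\<bar> \<le> 1" by linarith
      ultimately show ?thesis using a by (simp add: abs_mult)
    qed
    hence r: "norm (emb w - u) \<le> (\<Sum>i\<in>(UNIV :: 'n set). a)"
      by (intro order_trans[OF norm_le_l1_cart] sum_mono)
    obtain w' where w': "emb w' = (((*v) M) ^^ n) (emb w)"
      "\<forall>z. (srs ^^ n) (z + w) = (srs ^^ n) z + w'"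
      using srs_pow_shift[of n v] unfolding w_def by blast
    have "V *v emb w' - t = P *v (emb w - u)"
      unfolding w'(1) P u by (simp add: matrix_vector_mult_diff_distrib)
    hence "norm (V *v emb w' - t) \<le> onorm ((*v) P) * (\<Sum>i\<in>(UNIV :: 'n set). a)"
      using order_trans[OF onorm_matrix mult_left_mono[OF r]]
      by (simp add: onorm_pos_le matrix_vector_mul_bounded_linear)
    with w' show "\<exists>w w'. norm (V *v emb w' - t) \<le> onorm ((*v) P) * (\<Sum>i\<in>(UNIV :: 'n set). a)
      \<and> V *v emb w' = ((*v) (matrix_inv (B_mat A)) ^^ n) (V *v emb w)
      \<and> (\<forall>z. (srs ^^ n) (z + w) = (srs ^^ n) z + w')"
      unfolding matrix_inv_B_pow_V by (intro exI[of _ w] exI[of _ w']) simp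
  qed
qed

text \<open>The rounding error of \<open>srs\<close> is at most 1 before \<open>V\<close> is
  applied, so the operator norm of \<open>V\<close> serves as error constant.\<close>

sublocale srs: contracting_radix_system "\<lambda>z. V *v emb z" "(*v) (matrix_inv (B_mat A))" srs "onorm ((*v) V)"
proof (rule contracting_radix_system.intro)
  show "linear ((*v) (matrix_inv (B_mat A)) :: real ^ 'n::{finite,wellorder} \<Rightarrow> _)" by (rule matrix_vector_mul_linear)
  show "inj ((*v) (matrix_inv (B_mat A)) :: real ^ 'n::{finite,wellorder} \<Rightarrow> _)"
  proof (rule inj_matrix_vector_mult)
    have "invertible (matrix_inv V)"
      using matrix_inv_left[OF invertible_V] matrix_inv_right[OF invertible_V] unfolding invertible_def by blast
    thus "invertible (matrix_inv (B_mat A) :: real ^ 'n::{finite,wellorder} ^ 'n::{finite,wellorder})"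
      unfolding matrix_inv_B by (intro invertible_mult invertible_V invertible_M)
  qed
  show "V *v emb (x + y) = V *v emb x + V *v emb y" for x y
    by (simp add: emb_add matrix_vector_right_distrib)
  show "norm (V *v emb (srs z) - matrix_inv (B_mat A) *v (V *v emb z)) \<le> onorm ((*v) V)" for z
  proof -
    have "norm (V *v (emb (srs z) - M *v emb z)) \<le> onorm ((*v) V) * norm (emb (srs z) - M *v emb z)"
      by (rule onorm_matrix)
    also have "\<dots> \<le> onorm ((*v) V)"
      using mult_left_mono[OF srs_near[of z] onorm_pos_le[OF matrix_vector_mul_bounded_linear, of V]] by simp
    finally show ?thesis by (simp add: matrix_inv_B_V matrix_vector_mult_diff_distrib)
  qed
qed (rule summable_matrix_inv_B surj_srs finite_bounded_emb quasi_periodic_srs)+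

end

section \<open>Brunotte tiles\<close>

text \<open>Brunotte tiles are indexed by cosets, the tiles of the radix system by coordinate
  vectors; each condition on a weak tiling transfers along an injective relabelling.\<close>

lemma weak_m_tiling_reindex:
  fixes f :: "'i \<Rightarrow> 'j" and T :: "'i \<Rightarrow> 'a::euclidean_space set"
  assumes "inj f" "\<And>x. K (f x) = T x"
  shows "weak_m_tiling m (range f) K \<longleftrightarrow> weak_m_tiling m UNIV T"
proof -
  have inj: "inj_on f S" for S using assms(1) by (rule inj_on_subset) simp
  have "{i \<in> range f. ball x r \<inter> K i \<noteq> {}} = f ` {y \<in> UNIV. ball x r \<inter> T y \<noteq> {}}" for x r
    using assms(2) by auto
  hence "locally_finite_family (range f) K \<longleftrightarrow> locally_finite_family UNIV T"
    unfolding locally_finite_family_def by (simp add: finite_image_iff[OF inj])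
  moreover have "{i \<in> range f. t \<in> K i} = f ` {y \<in> UNIV. t \<in> T y}" for t
    using assms(2) by auto
  hence "covering_degree (range f) K = covering_degree UNIV T"
    unfolding covering_degree_def covering_degree_at_def by (simp add: card_image[OF inj])
  moreover have "(\<forall>J. J \<subseteq> range f \<and> card J = m + 1 \<longrightarrow> (\<Inter>i\<in>J. interior (K i)) = {}) \<longleftrightarrow>
      (\<forall>J. card J = m + 1 \<longrightarrow> (\<Inter>i\<in>J. interior (T i)) = {})"
  proof (intro iffI allI impI)
    fix J :: "'i set"
    assume *: "\<forall>J. J \<subseteq> range f \<and> card J = m + 1 \<longrightarrow> (\<Inter>i\<in>J. interior (K i)) = {}" and "card J = m + 1"
    hence "(\<Inter>i\<in>f ` J. interior (K i)) = {}" by (intro *[rule_format]) (simp add: card_image[OF inj] image_mono)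
    thus "(\<Inter>i\<in>J. interior (T i)) = {}" by (simp add: assms(2))
  next
    fix J :: "'j set"
    assume *: "\<forall>J. card J = m + 1 \<longrightarrow> (\<Inter>i\<in>J. interior (T i)) = {}" and J: "J \<subseteq> range f \<and> card J = m + 1"
    then obtain I where I: "J = f ` I" by (meson subset_imageE)
    hence "(\<Inter>i\<in>I. interior (T i)) = {}" using J by (intro *[rule_format]) (simp add: card_image[OF inj])
    thus "(\<Inter>i\<in>J. interior (K i)) = {}" by (simp add: I assms(2))
  qed
  ultimately show ?thesis unfolding weak_m_tiling_def using assms(2) by simp
qed

section \<open>Digit representations and backward division\<close>

lemma qcls_minus: "qcls A p \<ominus>\<^bsub>Q A\<^esub> qcls A p' = qcls A (p - p')"
proof -
  interpret cring "Q A" by (rule cring_Q)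
  have "\<ominus>\<^bsub>Q A\<^esub> qcls A p' = qcls A (- p')"
    by (rule minus_equality) (simp_all add: carrier_Q qcls_add qcls_zero)
  thus ?thesis by (simp add: a_minus_def qcls_add)
qed

lemma qX_pow: "qX A [^]\<^bsub>Q A\<^esub> (n :: nat) = qcls A ([:0, 1:] ^ n)"
proof -
  interpret cring "Q A" by (rule cring_Q)
  show ?thesis by (induction n) (simp_all add: qX_def qcls_one qcls_mult mult.commute)
qed

lemma is_representation_qcls:
  "is_representation A N (qcls A p) b \<longleftrightarrow>
    (\<forall>n. b n \<in> N) \<and> (\<forall>k. \<exists>g. A dvd p - (\<Sum>n<k. of_int (b n) * [:0, 1:] ^ n) - [:0, 1:] ^ k * g)"
  unfolding is_representation_def carrier_Q qX_pow qcls_add_pow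
  by (simp add: qcls_finsum qcls_minus qcls_mult qcls_eq_iff Bex_def image_iff flip: ex_simps)

text \<open>Modulo \<open>A\<close> this says that \<open>p\<close> is its first digit plus
  \<open>X\<close> times its backward quotient.\<close>

lemma X_mult_backward_div_poly:
  assumes "coeff A 0 > 0"
  shows "[:0, 1:] * backward_div_poly A p = p - of_int (coeff p 0 mod coeff A 0) - of_int (coeff p 0 div coeff A 0) * A"
proof -
  have "[:0, 1:] * backward_div_poly A p = pCons 0 (backward_div_poly A p)" by simp
  also have "\<dots> = p - [: coeff p 0 :] - Polynomial.smult (coeff p 0 div coeff A 0) (A - [: coeff A 0 :])"
    by (rule backward_div_poly_eq[OF assms])
  also have "\<dots> = p - [:coeff p 0 - coeff p 0 div coeff A 0 * coeff A 0:] - of_int (coeff p 0 div coeff A 0) * A"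
    by (simp add: of_int_poly smult_diff_right diff_pCons[symmetric] del: diff_pCons)
  finally show ?thesis by (simp add: minus_div_mult_eq_mod of_int_poly)
qed

text \<open>Comparing constant coefficients shows that the cofactor of \<open>A\<close> is itself
  divisible by \<open>X\<close>, so \<open>X\<close> can be cancelled in the quotient ring.\<close>

lemma dvd_cancel_X:
  fixes A h :: "int poly"
  assumes "coeff A 0 \<noteq> 0" "A dvd [:0, 1:] * h"
  shows "A dvd h"
proof -
  obtain f where f: "[:0, 1:] * h = A * f" using assms(2) by (auto simp: dvd_def)
  obtain f0 g where g: "f = pCons f0 g" by (cases f)
  from f have "coeff A 0 * f0 = 0" by (metis coeff_mult_0 coeff_pCons_0 g mult_zero_left)
  with assms(1) g f have "[:0, 1:] * h = [:0, 1:] * (A * g)" by simp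
  thus ?thesis by simp
qed

text \<open>Constant coefficients modulo \<open>coeff A 0\<close> force the first digit; removing it
  and cancelling \<open>X\<close> leaves a representation of the backward quotient. Thus any
  representation has the digits produced by iterated backward division.\<close>

lemma is_representation_step:
  assumes a0: "coeff A 0 > 0" and b: "is_representation A {0..coeff A 0 - 1} (qcls A p) b"
  shows "b 0 = coeff p 0 mod coeff A 0"
    and "is_representation A {0..coeff A 0 - 1} (qcls A (backward_div_poly A p)) (\<lambda>n. b (Suc n))"
proof -
  let ?x = "[:0, 1:] :: int poly"
  have N: "\<And>n. b n \<in> {0..coeff A 0 - 1}"
    and rep: "\<And>k. \<exists>g. A dvd p - (\<Sum>n<k. of_int (b n) * ?x ^ n) - ?x ^ k * g"
    using b unfolding is_representation_qcls by auto
  obtain g f where "p - of_int (b 0) - ?x * g = A * f" using rep[of 1] by (auto simp: dvd_def)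
  hence "coeff (p - of_int (b 0) - ?x * g) 0 = coeff (A * f) 0" by simp
  hence "coeff p 0 = b 0 + coeff A 0 * coeff f 0" by (simp add: coeff_mult_0 of_int_poly)
  moreover have "b 0 mod coeff A 0 = b 0" using N[of 0] by simp
  ultimately show b0: "b 0 = coeff p 0 mod coeff A 0" by simp
  have "\<exists>g. A dvd backward_div_poly A p - (\<Sum>n<k. of_int (b (Suc n)) * ?x ^ n) - ?x ^ k * g" for k
  proof -
    obtain g where g: "A dvd p - (\<Sum>n<Suc k. of_int (b n) * ?x ^ n) - ?x ^ Suc k * g" using rep by blast
    have "p - (\<Sum>n<Suc k. of_int (b n) * ?x ^ n) - ?x ^ Suc k * g
      = (p - of_int (b 0)) - ?x * ((\<Sum>n<k. of_int (b (Suc n)) * ?x ^ n) + ?x ^ k * g)"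
      by (simp only: sum.lessThan_Suc_shift sum_distrib_left distrib_left) (simp add: algebra_simps)
    also have "p - of_int (b 0) = ?x * backward_div_poly A p + of_int (coeff p 0 div coeff A 0) * A"
      unfolding X_mult_backward_div_poly[OF a0] b0 by simp
    finally have "A dvd ?x * backward_div_poly A p + of_int (coeff p 0 div coeff A 0) * A
        - ?x * ((\<Sum>n<k. of_int (b (Suc n)) * ?x ^ n) + ?x ^ k * g)" using g by simp
    hence "A dvd (?x * backward_div_poly A p + of_int (coeff p 0 div coeff A 0) * A
        - ?x * ((\<Sum>n<k. of_int (b (Suc n)) * ?x ^ n) + ?x ^ k * g)) - of_int (coeff p 0 div coeff A 0) * A"
      by (rule dvd_diff) simp
    hence h: "A dvd ?x * (backward_div_poly A p - (\<Sum>n<k. of_int (b (Suc n)) * ?x ^ n) - ?x ^ k * g)"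
      by (simp only: algebra_simps) (simp add: algebra_simps)
    have "coeff A 0 \<noteq> 0" using a0 by simp
    from dvd_cancel_X[OF this h] show ?thesis by (rule exI[of _ g])
  qed
  with N show "is_representation A {0..coeff A 0 - 1} (qcls A (backward_div_poly A p)) (\<lambda>n. b (Suc n))"
    unfolding is_representation_qcls by blast
qed

text \<open>One step beyond the basis the recursion arrives at \<open>A\<close>, which vanishes in
  the quotient ring.\<close>

lemma W_poly_degree: "W_poly A (degree A) = A"
  by (rule poly_eqI) (auto simp: coeff_W_poly intro: coeff_eq_0)

lemma pCons_0_W_poly: "pCons 0 (W_poly A k) = W_poly A (Suc k) - [:coeff A (degree A - Suc k):]"
  by simp

section \<open>Backward division in the Brunotte basis\<close>

context expanding_integer_poly
begin

definition W_comb :: "int ^ 'n::{finite,wellorder} \<Rightarrow> int poly" where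
  "W_comb z = (\<Sum>i\<in>UNIV. of_int (z $ i) * W_poly A (pos i))"

lemma coeff_W_comb_0: "coeff (W_comb z) 0 = const_term z"
proof -
  have "pos i \<le> degree A" for i :: 'n using pos_less[of i] degree_A by simp
  thus ?thesis
    by (simp add: W_comb_def const_term_def coeff_sum of_int_poly coeff_W_poly mult.commute)
qed

text \<open>The identity holds between polynomials, not only modulo \<open>A\<close>; it is checked
  after multiplication by \<open>X\<close>.\<close>

lemma backward_div_poly_W_comb: "backward_div_poly A (W_comb z) = W_comb (srs z)"
proof -
  obtain m where m: "CARD('n) = Suc m" using zero_less_card_finite[where 'a = 'n] by (metis gr0_conv_Suc)
  \<comment> \<open>\<open>G (Suc k)\<close> is \<open>X\<close> times \<open>W_poly A k\<close>.
    The vanishing of \<open>G 0\<close> permits the index shift of the sum, and the last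
    \<open>G\<close> is \<open>A\<close> without its constant coefficient, which is what backward
    division subtracts.\<close>
  define G where "G k = W_poly A k - [:coeff A (degree A - k):]" for k
  have G: "G 0 = 0" "G (Suc m) = A - [:coeff A 0:]"
    using W_poly_degree[of A] degree_A m by (simp_all add: G_def)
  have "pCons 0 (W_comb (srs z)) = (\<Sum>i\<in>UNIV. of_int (srs z $ i) * pCons 0 (W_poly A (pos i)))"
  proof -
    have "[:0, 1:] * W_comb (srs z) = (\<Sum>i\<in>UNIV. of_int (srs z $ i) * ([:0, 1:] * W_poly A (pos i)))"
      unfolding W_comb_def sum_distrib_left by (intro sum.cong) (simp_all only: mult.left_commute)
    thus ?thesis by simp
  qed
  also have "\<dots> = (\<Sum>i\<in>(UNIV :: 'n set). of_int (srs z $ index_at (pos i)) * G (Suc (pos i)))"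
    by (simp add: G_def pCons_0_W_poly del: W_poly.simps)
  also have "\<dots> = (\<Sum>k<Suc m. of_int (srs z $ index_at k) * G (Suc k))"
    unfolding sum_pos[of "\<lambda>k. of_int (srs z $ index_at k) * G (Suc k)"] m ..
  also have "\<dots> = (\<Sum>k<m. of_int (z $ index_at (Suc k)) * G (Suc k)) - of_int (const_term z div coeff A 0) * (A - [:coeff A 0:])"
  proof -
    have "srs z $ index_at k = z $ index_at (Suc k)" if "k < m" for k
      using that m pos_index_at[where 'n = 'n and k = k] by (simp add: srs_def)
    moreover have "srs z $ index_at m = - (const_term z div coeff A 0)"
      using m pos_index_at[where 'n = 'n and k = m] by (simp add: srs_def)
    ultimately show ?thesis by (simp add: G(2))
  qed
  also have "(\<Sum>k<m. of_int (z $ index_at (Suc k)) * G (Suc k)) = (\<Sum>k<Suc m. of_int (z $ index_at k) * G k)"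
    by (subst sum.lessThan_Suc_shift) (simp add: G(1))
  also have "\<dots> = (\<Sum>i\<in>(UNIV :: 'n set). of_int (z $ index_at (pos i)) * G (pos i))"
    unfolding sum_pos[of "\<lambda>k. of_int (z $ index_at k) * G k"] m ..
  also have "\<dots> = W_comb z - [:const_term z:]"
  proof -
    have "(\<Sum>i\<in>(UNIV :: 'n set). of_int (z $ i) * [:coeff A (degree A - pos i):]) = of_int (const_term z)"
      by (simp add: const_term_def of_int_poly mult.commute sum_to_poly)
    thus ?thesis by (simp add: G_def W_comb_def right_diff_distrib sum_subtractf of_int_poly)
  qed
  finally have "pCons 0 (W_comb (srs z)) = pCons 0 (backward_div_poly A (W_comb z))"
    using coeff_0_ge by (simp add: backward_div_poly_eq coeff_W_comb_0 of_int_poly)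
  thus ?thesis by simp
qed

lemma brunotte_comb_W: "brunotte_comb A z = qcls A (W_comb z)"
  by (simp add: brunotte_comb_eq W_comb_def)

lemma backward_div_comb: "(backward_div A ^^ n) (brunotte_comb A z) = brunotte_comb A ((srs ^^ n) z)"
  using coeff_0_ge
  by (induction n) (simp_all add: brunotte_comb_W backward_div_qcls backward_div_poly_W_comb)

text \<open>Backward division maps the Brunotte module into itself, where it is \<open>srs\<close>
  in coordinates. So the part of the iterated preimage inside the module is exactly a fibre of
  \<open>srs ^^ n\<close>.\<close>

lemma brunotte_tile_comb: "brunotte_tile A (brunotte_comb A x) = srs.tile x"
proof -
  have "{R \<in> carrier (Q A). (backward_div A ^^ n) R = brunotte_comb A x} \<inter> brunotte_module A
      = brunotte_comb A ` {y. (srs ^^ n) y = x}" for n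
    unfolding range_brunotte_comb[OF degree_A, symmetric]
    using inj_eq[OF brunotte_comb_inj[OF degree_A]] backward_div_comb
    by (auto simp: brunotte_comb_W carrier_Q)
  moreover have "(\<chi> i. real_of_int (brunotte_Psi A (brunotte_comb A y) $ i)) = emb y" for y
    by (simp add: brunotte_Psi_comb[OF degree_A] emb_def)
  ultimately show ?thesis
    unfolding brunotte_tile_def srs.tile_def by (simp add: image_image mat_power_eq_funpow)
qed

lemma weak_m_tiling_brunotte_iff:
  "weak_m_tiling m (brunotte_module A) (brunotte_tile A :: _ \<Rightarrow> (real ^ 'n::{finite,wellorder}) set)
    \<longleftrightarrow> weak_m_tiling m UNIV srs.tile"
  unfolding range_brunotte_comb[OF degree_A, symmetric]
  by (rule weak_m_tiling_reindex[where f = "brunotte_comb A" and T = srs.tile, OF brunotte_comb_inj[OF degree_A] brunotte_tile_comb])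

text \<open>The digits are the residues of the constant terms along the orbit. Once they are all 0
  no rounding occurs, the orbit follows the contraction \<open>M\<close>, and an integer vector of
  norm below 1 is 0.\<close>

lemma srs_finiteness_property:
  assumes "CNS A {0..coeff A 0 - 1}"
  shows "\<exists>n. (srs ^^ n) z = 0"
proof -
  have "qcls A (W_comb z) \<in> carrier (Q A)" by (simp add: carrier_Q)
  then obtain b where b: "is_representation A {0..coeff A 0 - 1} (qcls A (W_comb z)) b" "finite {n. b n \<noteq> 0}"
    using assms unfolding CNS_def by blast
  have rep: "is_representation A {0..coeff A 0 - 1} (qcls A (W_comb ((srs ^^ k) z))) (\<lambda>n. b (n + k))" for k
  proof (induction k)
    case (Suc k)
    from is_representation_step(2)[OF _ this] coeff_0_ge show ?case
      by (simp add: backward_div_poly_W_comb)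
  qed (simp add: b(1))
  have digit: "const_term ((srs ^^ k) z) mod coeff A 0 = b k" for k
    using is_representation_step(1)[OF _ rep[of k]] coeff_0_ge by (simp add: coeff_W_comb_0)
  obtain N where N: "\<And>n. n \<ge> N \<Longrightarrow> b n = 0"
    using b(2) by (metis (mono_tags, lifting) finite_nat_set_iff_bounded_le mem_Collect_eq not_less_eq_eq)
  define y where "y = (srs ^^ N) z"
  have y: "emb ((srs ^^ k) y) = (((*v) M) ^^ k) (emb y)" for k
  proof (induction k)
    case (Suc k)
    have "coeff A 0 dvd const_term ((srs ^^ k) y)"
      using digit[of "k + N"] N[of "k + N"] by (simp add: y_def funpow_add mod_eq_0_iff_dvd)
    from srs_exact[OF this] Suc show ?case by simp
  qed simp
  have "(\<lambda>k. norm (emb ((srs ^^ k) y))) \<longlonglongrightarrow> 0"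
    unfolding y mat_power_eq_funpow[symmetric] using coeff_0_ge
    by (intro summable_LIMSEQ_zero summable_M_mat_power degree_A expanding_A) auto
  hence "\<forall>\<^sub>F k in sequentially. norm (emb ((srs ^^ k) y)) < 1" by (intro order_tendstoD) auto
  then obtain k where k: "norm (emb ((srs ^^ k) y)) < 1" by (auto simp: eventually_sequentially)
  have "((srs ^^ k) y) $ i = 0" for i
    using order_le_less_trans[OF component_le_norm_cart k, of i] by simp
  hence "(srs ^^ (k + N)) z = 0" by (simp add: vec_eq_iff funpow_add y_def)
  thus ?thesis by blast
qed

lemma srs_zero: "srs 0 = 0"
  by (simp add: srs_def const_term_def vec_eq_iff)

end

theorem theorem5p15:
  fixes A :: "int poly"
  assumes "degree A = CARD('n::{finite,wellorder})"
    and "coeff A 0 \<ge> 2"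
    and "expanding A"
  shows "(\<exists>m\<ge>1. weak_m_tiling m (brunotte_module A)
                  (brunotte_tile A :: int poly set \<Rightarrow> (real ^ 'n::{finite,wellorder}) set)) \<and>
         (CNS A {0..coeff A 0 - 1} \<longrightarrow>
            weak_tiling (brunotte_module A)
              (brunotte_tile A :: int poly set \<Rightarrow> (real ^ 'n::{finite,wellorder}) set))"
proof -
  interpret expanding_integer_poly A "TYPE('n)"
    using assms by unfold_locales
  \<comment> \<open>The upper bound comes from the CNS property, the lower bound from
    covering.\<close>
  have "covering_degree UNIV srs.tile = 1" if "CNS A {0..coeff A 0 - 1}"
    using srs.covering_degree_le_1[OF srs_finiteness_property[OF that] srs_zero] srs.weak_m_tiling_tile(2)
    by (rule antisym)
  thus ?thesis
    unfolding weak_m_tiling_brunotte_iff using srs.weak_m_tiling_tile by auto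
qed

end
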